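(* Let $G$ be a graph and let $G_1,\ldots,G_r$ be its connected components. Then (a) $I_c(G)=I_c(G_1)\cdots I_c(G_r)$; (b) $\overline{I_c(G)^n}=\overline{I_c(G_1)^n}\cdots\overline{I_c(G_r)^n}$ for all $n\geq 1$; and (c) $I_c(G)$ is normal if and only if $I_c(G_i)$ is normal for $i=1,\ldots,r$.
   Context: Graphs are finite, with no multiple edges or loops. The vertices of $G$, $V(G)=\{t_1,\ldots,t_s\}$, are regarded as variables of the polynomial ring $S=K[t_1,\ldots,t_s]$ over a field $K$. A vertex cover is a set of vertices meeting every edge; it is minimal if minimal with respect to inclusion. The ideal of covers $I_c(G)$ is generated by all squarefree monomials $\prod_{t_i\in C}t_i$ with $C$ a minimal vertex cover of $G$; for a graph with no edges the ideal of covers is the whole ring. Each $I_c(G_i)$ is regarded as an ideal of $S$ (generated by the corresponding monomials in the variables of $V(G_i)$). For an ideal $J$, $\overline{J}$ is its integral closure, and $J$ is normal if $J^n=\overline{J^n}$ for all $n\geq 1$. *)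

theory Defs
  imports
    "HOL-Algebra.Ideal_Product"
    "HOL-Library.Poly_Mapping"
    "Graph_Theory.Digraph_Component"
begin

section \<open>Polynomial rings over a field\<close>

type_synonym ('v, 'k) mpoly = "('v \<Rightarrow>\<^sub>0 nat) \<Rightarrow>\<^sub>0 'k"

definition var :: "'v \<Rightarrow> ('v, 'k::field) mpoly" where
  "var t = Poly_Mapping.single (Poly_Mapping.single t 1) 1"

text \<open>The ring K[V]. The type of all multivariate polynomials has one variable for
  every element of the type of vertices, so the carrier restricts to the polynomials
  whose monomials only involve variables in V.\<close>

definition poly_ring :: "'v set \<Rightarrow> ('v, 'k::field) mpoly ring" where
  "poly_ring V =
    \<lparr>carrier = {p. \<forall>m \<in> Poly_Mapping.keys p. Poly_Mapping.keys m \<subseteq> V},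
     monoid.mult = (*), one = 1, zero = 0, add = (+)\<rparr>"

lemma poly_ring_mult_closed:
  fixes p q :: "('v, 'k::field) mpoly"
  assumes "p \<in> carrier (poly_ring V)" "q \<in> carrier (poly_ring V)"
  shows "p * q \<in> carrier (poly_ring V)"
proof -
  have "Poly_Mapping.keys m \<subseteq> V" if "m \<in> Poly_Mapping.keys (p * q)" for m
  proof -
    from that Poly_Mapping.keys_mult[of p q] obtain a b
      where ab: "m = a + b" "a \<in> Poly_Mapping.keys p" "b \<in> Poly_Mapping.keys q" by blast
    with assms have "Poly_Mapping.keys a \<subseteq> V" "Poly_Mapping.keys b \<subseteq> V" by (auto simp: poly_ring_def)
    with Poly_Mapping.keys_add[of a b] ab show ?thesis by blast
  qed
  then show ?thesis by (auto simp: poly_ring_def)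
qed

lemma cring_poly_ring: "cring (poly_ring V :: ('v, 'k::field) mpoly ring)"
proof (rule cringI)
  show "abelian_group (poly_ring V :: ('v, 'k) mpoly ring)"
  proof (rule abelian_groupI)
    fix x y :: "('v, 'k) mpoly"
    assume "x \<in> carrier (poly_ring V)" "y \<in> carrier (poly_ring V)"
    then show "x \<oplus>\<^bsub>poly_ring V\<^esub> y \<in> carrier (poly_ring V)"
      using Poly_Mapping.keys_add[of x y] by (auto simp: poly_ring_def)
  next
    fix x :: "('v, 'k) mpoly"
    assume "x \<in> carrier (poly_ring V)"
    then show "\<exists>y\<in>carrier (poly_ring V). y \<oplus>\<^bsub>poly_ring V\<^esub> x = \<zero>\<^bsub>poly_ring V\<^esub>"
      by (intro bexI[of _ "- x"]) (auto simp: poly_ring_def)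
  qed (auto simp: poly_ring_def algebra_simps)
  show "comm_monoid (poly_ring V :: ('v, 'k) mpoly ring)"
  proof (rule comm_monoidI)
    fix x y :: "('v, 'k) mpoly"
    assume "x \<in> carrier (poly_ring V)" "y \<in> carrier (poly_ring V)"
    then show "x \<otimes>\<^bsub>poly_ring V\<^esub> y \<in> carrier (poly_ring V)"
      using poly_ring_mult_closed[of x V y] by (simp add: poly_ring_def)
  qed (auto simp: poly_ring_def algebra_simps)
qed (auto simp: poly_ring_def algebra_simps)


section \<open>Integral closure and normality of ideals\<close>

text \<open>In the monoid \<^term>\<open>ideals_set R\<close> of all ideals of R, multiplication is the product of
  ideals and the unit is R; powers and finite products of ideals are taken there.\<close>

abbreviation ideal_pow :: "('a, 'b) ring_scheme \<Rightarrow> 'a set \<Rightarrow> nat \<Rightarrow> 'a set" where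
  "ideal_pow R J n \<equiv> J [^]\<^bsub>ideals_set R\<^esub> n"

definition integral_closure :: "('a, 'b) ring_scheme \<Rightarrow> 'a set \<Rightarrow> 'a set" where
  "integral_closure R J =
    {x \<in> carrier R. \<exists>l::nat. \<exists>a. 1 \<le> l \<and> (\<forall>i \<in> {1..l}. a i \<in> ideal_pow R J i) \<and>
       x [^]\<^bsub>R\<^esub> l \<oplus>\<^bsub>R\<^esub> (\<Oplus>\<^bsub>R\<^esub>i \<in> {1..l}. a i \<otimes>\<^bsub>R\<^esub> x [^]\<^bsub>R\<^esub> (l - i)) = \<zero>\<^bsub>R\<^esub>}"

definition normal_ideal :: "('a, 'b) ring_scheme \<Rightarrow> 'a set \<Rightarrow> bool" where
  "normal_ideal R J \<longleftrightarrow>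
    (\<forall>n\<ge>1. ideal_pow R J n = integral_closure R (ideal_pow R J n))"


section \<open>Ideals of covers\<close>

text \<open>Following the digraph library, a simple graph is a finite, symmetric, loop-free digraph
  without parallel arcs (locale \<^locale>\<open>graph\<close>): an edge is a pair of opposite arcs.\<close>

definition vertex_cover :: "('v, 'e) pre_digraph \<Rightarrow> 'v set \<Rightarrow> bool" where
  "vertex_cover G C \<longleftrightarrow> C \<subseteq> verts G \<and> (\<forall>e \<in> arcs G. tail G e \<in> C \<or> head G e \<in> C)"

definition minimal_vertex_cover :: "('v, 'e) pre_digraph \<Rightarrow> 'v set \<Rightarrow> bool" where
  "minimal_vertex_cover G C \<longleftrightarrow> vertex_cover G C \<and> (\<forall>D. D \<subset> C \<longrightarrow> \<not> vertex_cover G D)"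

text \<open>The ideal of covers of G, as an ideal of a polynomial ring R whose variables include the
  vertices of G. If G has no edges, its only minimal vertex cover is the empty set, and the
  corresponding empty product 1 generates the whole ring.\<close>

definition cover_ideal ::
    "('v, 'k::field) mpoly ring \<Rightarrow> ('v, 'e) pre_digraph \<Rightarrow> ('v, 'k) mpoly set" where
  "cover_ideal R G = Idl\<^bsub>R\<^esub> {\<Prod>t\<in>C. var t | C. minimal_vertex_cover G C}"

definition connected_components :: "('v, 'e) pre_digraph \<Rightarrow> ('v, 'e) pre_digraph set" where
  "connected_components G = {H. pre_digraph.max_subgraph G Digraph_Component.connected H}"

end

theory Submission
  imports Defs "HOL-Library.Set_Algebras" "Jordan_Normal_Form.Char_Poly"
begin

text \<open>
  Ideals of covers are monomial ideals, and everything in the theorem can be expressed by exponents.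
  A monomial ideal of \<open>K[V]\<close> corresponds to an upward closed set \<open>U\<close> of exponent vectors; products of
  ideals become sums of sets, and powers become iterated sums. The one fact that leaves this
  dictionary is the description of the integral closure (\<open>integral_closure_monomial_ideal\<close>): it is again
  a monomial ideal, spanned by the monomials \<open>x\<^sup>m\<close> such that \<open>l m\<close> lies in the \<open>l\<close>-fold sum of \<open>U\<close>
  for some \<open>l \<ge> 1\<close> (\<open>newton_closure\<close>).

  For one inclusion, an integral element \<open>f\<close> satisfies \<open>f\<^sup>N \<in> J\<^sup>N\<^sup>-\<^sup>c\<close> for a constant \<open>c\<close> and all
  \<open>N\<close>. This property passes to an extreme monomial of \<open>f\<close>, whose powers cannot cancel, and then by
  subtraction to all monomials of \<open>f\<close> (\<open>almost_integral_monomials\<close>). For a single monomial Dickson's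
  lemma removes the constant \<open>c\<close> (\<open>almost_power_imp_newton_closure\<close>). For the other inclusion, a sum of
  integral monomials multiplies the span of a suitable finite set of monomials into its multiple by
  the ideal (\<open>newton_closure_exchange\<close>), and the determinant trick yields an equation of integral
  dependence.

  The components of \<open>G\<close> have disjoint vertex sets, so the factors involve disjoint blocks of
  variables. Hence a monomial lies in the product if and only if its part in each block lies in
  the factor of that block (\<open>finprod_monomial_ideal\<close>). With this description powers and integral closures
  are computed block by block, which gives the formula for the closure of powers
  (\<open>integral_closure_pow_finprod\<close>). A product of nonzero ideals in disjoint variables determines its factors
  (\<open>blockwise_subset_imp\<close>); this gives the equivalence of normality (\<open>normal_finprod_iff\<close>). Finally, a
  minimal cover of \<open>G\<close> is the same as a choice of a minimal cover of each component
  (\<open>cover_upset_eq_blockwise\<close>), which is the factorization of \<open>I\<^sub>c(G)\<close>.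
\<close>

section \<open>Exponent vectors and upward closed sets\<close>

definition exponents :: "'v set \<Rightarrow> ('v \<Rightarrow>\<^sub>0 nat) set" where
  "exponents V = {m. Poly_Mapping.keys m \<subseteq> V}"

definition scale :: "nat \<Rightarrow> ('v \<Rightarrow>\<^sub>0 nat) \<Rightarrow> ('v \<Rightarrow>\<^sub>0 nat)" where
  "scale l m = (\<Sum>i<l. m)"

definition restrict_exponent :: "'v set \<Rightarrow> ('v \<Rightarrow>\<^sub>0 nat) \<Rightarrow> ('v \<Rightarrow>\<^sub>0 nat)" where
  "restrict_exponent W m = Abs_poly_mapping (\<lambda>t. if t \<in> W then Poly_Mapping.lookup m t else 0)"

text \<open>The exponent sets of the monomial ideals of \<open>K[V]\<close>.\<close>

definition upset :: "'v set \<Rightarrow> ('v \<Rightarrow>\<^sub>0 nat) set \<Rightarrow> bool" where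
  "upset V U \<longleftrightarrow> U \<subseteq> exponents V \<and> (\<forall>u\<in>U. \<forall>x\<in>exponents V. u + x \<in> U)"

text \<open>The exponent set of the \<open>n\<close>-th power of a monomial ideal. The recursion follows that of powers in a
monoid; the power with exponent 0 is the whole ring, so it starts from all exponents and not
from \<open>{0}\<close>.\<close>

primrec upset_power :: "'v set \<Rightarrow> ('v \<Rightarrow>\<^sub>0 nat) set \<Rightarrow> nat \<Rightarrow> ('v \<Rightarrow>\<^sub>0 nat) set" where
  "upset_power V U 0 = exponents V"
| "upset_power V U (Suc n) = upset_power V U n + U"

text \<open>The lattice points of the Newton polyhedron of \<open>U\<close>, that is, of the convex hull of \<open>U\<close>. The polyhedron
has rational vertices, so a lattice point \<open>m\<close> in it is a rational convex combination of
elements of \<open>U\<close>; clearing denominators gives a multiple \<open>l m\<close> that is a sum of \<open>l\<close> of them. Said in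
these terms no convexity is needed, and the condition is the equation
\<open>T\<^sup>l - x\<^sup>l\<^sup>m = 0\<close> of integral dependence of \<open>x\<^sup>m\<close>.\<close>

definition newton_closure :: "'v set \<Rightarrow> ('v \<Rightarrow>\<^sub>0 nat) set \<Rightarrow> ('v \<Rightarrow>\<^sub>0 nat) set" where
  "newton_closure V U = {m \<in> exponents V. \<exists>l\<ge>1. scale l m \<in> upset_power V U l}"

lemma lookup_scale [simp]: "Poly_Mapping.lookup (scale l m) t = l * Poly_Mapping.lookup m t"
  by (simp add: scale_def lookup_sum)

lemma lookup_restrict_exponent [simp]:
  "Poly_Mapping.lookup (restrict_exponent W m) t = (if t \<in> W then Poly_Mapping.lookup m t else 0)"
proof -
  have "finite {t. (if t \<in> W then Poly_Mapping.lookup m t else 0) \<noteq> 0}"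
    by (rule finite_subset[OF _ finite_lookup[of m]]) auto
  then show ?thesis by (simp add: restrict_exponent_def)
qed

lemma exponents_iff_lookup: "m \<in> exponents V \<longleftrightarrow> (\<forall>t. t \<notin> V \<longrightarrow> Poly_Mapping.lookup m t = 0)"
  by (auto simp: exponents_def in_keys_iff)

lemma scale_add_left: "scale (a + b) m = scale a m + scale b m"
  and scale_add: "scale l (m + n) = scale l m + scale l n"
  and scale_scale: "scale a (scale b m) = scale (a * b) m"
  and scale_0 [simp]: "scale 0 m = 0"
  and scale_1 [simp]: "scale 1 m = m" "scale (Suc 0) m = m"
  and scale_Suc: "scale (Suc l) m = scale l m + m"
  by (rule poly_mapping_eqI; simp add: lookup_add algebra_simps)+

lemma restrict_exponent_add: "restrict_exponent W (m + n) = restrict_exponent W m + restrict_exponent W n"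
  and restrict_exponent_scale: "restrict_exponent W (scale l m) = scale l (restrict_exponent W m)"
  by (rule poly_mapping_eqI; simp add: lookup_add)+

lemma zero_in_exponents [simp]: "0 \<in> exponents V"
  and exponents_add: "m \<in> exponents V \<Longrightarrow> n \<in> exponents V \<Longrightarrow> m + n \<in> exponents V"
  and exponents_scale: "m \<in> exponents V \<Longrightarrow> scale l m \<in> exponents V"
  and exponents_restrict: "m \<in> exponents V \<Longrightarrow> restrict_exponent W m \<in> exponents V"
  by (simp_all add: exponents_iff_lookup lookup_add)

lemma exponents_diff: "m \<in> exponents V \<Longrightarrow> m - n \<in> exponents V" for m n :: "'v \<Rightarrow>\<^sub>0 nat"
  by (simp add: exponents_iff_lookup lookup_minus)

lemma upset_le:
  assumes "upset V U" "u \<in> U" "m \<in> exponents V"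
    and le: "\<And>t. Poly_Mapping.lookup u t \<le> Poly_Mapping.lookup m t"
  shows "m \<in> U"
proof -
  have "m = u + (m - u)"
    by (rule poly_mapping_eqI) (simp add: lookup_add lookup_minus le)
  then show ?thesis using assms exponents_diff by (metis upset_def)
qed

lemma upset_subset: "upset V U \<Longrightarrow> u \<in> U \<Longrightarrow> u \<in> exponents V"
  by (auto simp: upset_def)

lemma upset_exponents [simp]: "upset V (exponents V)"
  by (simp add: upset_def exponents_add)

lemma upset_plus:
  assumes "upset V U" "upset V W"
  shows "upset V (U + W)"
  unfolding upset_def
proof (intro conjI ballI subsetI)
  fix x assume "x \<in> U + W"
  then show "x \<in> exponents V" using assms by (auto elim!: set_plus_elim intro!: exponents_add simp: upset_def)
next
  fix x y assume "x \<in> U + W" "y \<in> exponents V"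
  then obtain u w where "x = u + w" "u \<in> U" "w + y \<in> W"
    using assms by (auto elim!: set_plus_elim simp: upset_def)
  then show "x + y \<in> U + W" by (simp add: add.assoc set_plus_intro)
qed

lemma upset_upset_power: "upset V U \<Longrightarrow> upset V (upset_power V U n)"
  by (induction n) (auto intro: upset_plus)

lemma upset_generated:
  assumes "A \<subseteq> exponents V"
  shows "upset V (A + exponents V)"
  unfolding upset_def
proof (intro conjI ballI subsetI)
  fix x assume "x \<in> A + exponents V"
  then show "x \<in> exponents V" using assms by (auto elim!: set_plus_elim intro!: exponents_add)
next
  fix x y assume "x \<in> A + exponents V" "y \<in> exponents V"
  then obtain a w where "x = a + w" "a \<in> A" "w + y \<in> exponents V"
    by (auto elim!: set_plus_elim intro: exponents_add)
  then show "x + y \<in> A + exponents V" by (simp add: add.assoc set_plus_intro)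
qed

lemma upset_plus_exponents: 
  assumes "upset V U" shows "U + exponents V = U" "exponents V + U = U"
proof -
  have "u \<in> U + exponents V" if "u \<in> U" for u
    using set_plus_intro[OF that zero_in_exponents] by simp
  then show "U + exponents V = U" using assms by (auto elim!: set_plus_elim simp: upset_def)
  then show "exponents V + U = U" by (simp add: add.commute)
qed

lemma upset_power_add: "upset V U \<Longrightarrow> upset_power V U (a + b) = upset_power V U a + upset_power V U b"
  by (induction b) (simp_all add: upset_plus_exponents upset_upset_power add.assoc)

lemma upset_power_mult: "upset V U \<Longrightarrow> upset_power V (upset_power V U n) l = upset_power V U (n * l)"
  by (induction l) (simp_all add: upset_power_add add.commute)

lemma upset_power_1: "upset V U \<Longrightarrow> upset_power V U (Suc 0) = U"
  by (simp add: upset_plus_exponents)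

lemma upset_power_antimono:
  assumes "upset V U" "a \<le> b" shows "upset_power V U b \<subseteq> upset_power V U a"
proof -
  obtain c where b: "b = a + c" using assms le_Suc_ex by blast
  have "u + w \<in> upset_power V U a" if "u \<in> upset_power V U a" "w \<in> upset_power V U c" for u w
    using upset_upset_power[OF assms(1)] that by (meson upset_def subsetD)
  then show ?thesis using assms by (auto simp: b upset_power_add elim!: set_plus_elim)
qed

lemma scale_in_upset_power:
  assumes "m \<in> U"
  shows "scale l m \<in> upset_power V U l"
proof (induction l)
  case (Suc l)
  then show ?case using assms by (simp add: scale_Suc set_plus_intro)
qed simp

lemma upset_newton_closure:
  assumes "upset V U" shows "upset V (newton_closure V U)"
proof -
  have "m + x \<in> newton_closure V U" if "m \<in> newton_closure V U" and x: "x \<in> exponents V" for m x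
  proof -
    obtain l where l: "l \<ge> 1" "scale l m \<in> upset_power V U l" and m: "m \<in> exponents V" 
      using \<open>m \<in> newton_closure V U\<close> by (auto simp: newton_closure_def)
    then have "scale l (m + x) \<in> upset_power V U l"
      using upset_upset_power[OF assms, of l] exponents_scale[OF x, of l] by (simp add: upset_def scale_add)
    with l m x show ?thesis by (auto simp: newton_closure_def intro: exponents_add)
  qed
  then show ?thesis by (auto simp: upset_def newton_closure_def)
qed

lemma subset_newton_closure: "upset V U \<Longrightarrow> U \<subseteq> newton_closure V U"
  using upset_power_1[of V U] by (force simp: newton_closure_def upset_def intro: exI[of _ "Suc 0"])

section \<open>Blocks of variables\<close>

text \<open>For an upward closed set this says that the monomial ideal is generated by monomials in the
variables \<open>W\<close>. In this form the condition passes to powers and to the Newton closure without any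
choice of generators.\<close>

definition restriction_closed :: "'v set \<Rightarrow> ('v \<Rightarrow>\<^sub>0 nat) set \<Rightarrow> bool" where
  "restriction_closed W U \<longleftrightarrow> (\<forall>u\<in>U. restrict_exponent W u \<in> U)"

lemma restriction_closed_upset_power:
  assumes "restriction_closed W U" shows "restriction_closed W (upset_power V U n)"
proof (induction n)
  case 0
  then show ?case by (simp add: restriction_closed_def exponents_restrict)
next
  case (Suc n)
  then show ?case using assms
    by (auto simp: restriction_closed_def restrict_exponent_add elim!: set_plus_elim intro!: set_plus_intro)
qed

lemma restriction_closed_newton_closure:
  assumes "restriction_closed W U" shows "restriction_closed W (newton_closure V U)"
  using restriction_closed_upset_power[OF assms]
  by (fastforce simp: restriction_closed_def newton_closure_def exponents_restrict restrict_exponent_scale[symmetric])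

text \<open>The exponent set of the product of monomial ideals in pairwise disjoint blocks \<open>W i\<close> of
variables: a monomial lies in the product if and only if each of its factors \<open>restrict_exponent (W i) m\<close>
lies in the ideal of that block. It turns questions about sums over all blocks into
questions about one block at a time.\<close>

definition blockwise :: "'v set \<Rightarrow> 'i set \<Rightarrow> ('i \<Rightarrow> 'v set) \<Rightarrow> ('i \<Rightarrow> ('v \<Rightarrow>\<^sub>0 nat) set) \<Rightarrow> ('v \<Rightarrow>\<^sub>0 nat) set" where
  "blockwise V I W U = {m \<in> exponents V. \<forall>i\<in>I. restrict_exponent (W i) m \<in> U i}"

lemma upset_blockwise:
  assumes "\<And>i. i \<in> I \<Longrightarrow> upset V (U i)"
  shows "upset V (blockwise V I W U)"
  using assms by (auto simp: upset_def blockwise_def exponents_add restrict_exponent_add exponents_restrict)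

text \<open>A monomial is the product of its part in the block \<open>W a\<close> and the rest, and the rest has the same
parts in the other blocks.\<close>

lemma blockwise_insert:
  assumes up: "\<And>i. i \<in> insert a I \<Longrightarrow> upset V (U i)"
    and supp: "restriction_closed (W a) (U a)"
    and dis: "\<And>i. i \<in> I \<Longrightarrow> W i \<inter> W a = {}"
  shows "blockwise V (insert a I) W U = U a + blockwise V I W U"
proof (intro equalityI subsetI)
  fix m assume m: "m \<in> blockwise V (insert a I) W U"
  have "restrict_exponent (W i) (m - restrict_exponent (W a) m) = restrict_exponent (W i) m" if "i \<in> I" for i
    using dis[OF that] by (intro poly_mapping_eqI) (auto simp: lookup_minus)
  then have "m - restrict_exponent (W a) m \<in> blockwise V I W U"
    using m by (auto simp: blockwise_def exponents_diff)
  moreover have "restrict_exponent (W a) m \<in> U a" using m by (simp add: blockwise_def)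
  moreover have "m = restrict_exponent (W a) m + (m - restrict_exponent (W a) m)"
    by (rule poly_mapping_eqI) (simp add: lookup_add lookup_minus)
  ultimately show "m \<in> U a + blockwise V I W U" by (metis set_plus_intro)
next
  fix x assume "x \<in> U a + blockwise V I W U"
  then obtain u m where x: "x = u + m" and u: "u \<in> U a" and m: "m \<in> blockwise V I W U"
    by (auto elim: set_plus_elim)
  have uV: "u \<in> exponents V" and mV: "m \<in> exponents V"
    using up[of a] u m by (auto simp: upset_def blockwise_def)
  have "restrict_exponent (W i) x \<in> U i" if "i \<in> insert a I" for i
  proof (cases "i = a")
    case True
    have "restrict_exponent (W a) u \<in> U a" using supp u by (auto simp: restriction_closed_def)
    then show ?thesis using True up[of a] mV
      by (auto simp: x restrict_exponent_add upset_def exponents_restrict)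
  next
    case False
    then have "i \<in> I" using that by simp
    then have "restrict_exponent (W i) m \<in> U i" using m by (simp add: blockwise_def)
    then show ?thesis using up[OF that] uV
      by (auto simp: x restrict_exponent_add upset_def exponents_restrict add.commute)
  qed
  then show "x \<in> blockwise V (insert a I) W U" using uV mV by (simp add: blockwise_def x exponents_add)
qed

text \<open>Exponents may be prescribed independently on disjoint blocks.\<close>

lemma restrict_exponent_sum:
  assumes "finite I" "k \<in> I" and dis: "\<And>i j. i \<in> I \<Longrightarrow> j \<in> I \<Longrightarrow> i \<noteq> j \<Longrightarrow> W i \<inter> W j = {}"
  shows "restrict_exponent (W k) (\<Sum>j\<in>I. restrict_exponent (W j) (f j)) = restrict_exponent (W k) (f k)"
proof (rule poly_mapping_eqI)
  fix t
  have "(\<Sum>j\<in>I. if t \<in> W j then Poly_Mapping.lookup (f j) t else 0) = 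
    (\<Sum>j\<in>I. if j = k then Poly_Mapping.lookup (f j) t else 0)" if "t \<in> W k"
    using that dis[OF _ \<open>k \<in> I\<close>] by (intro sum.cong) auto
  then show "Poly_Mapping.lookup (restrict_exponent (W k) (\<Sum>j\<in>I. restrict_exponent (W j) (f j))) t
    = Poly_Mapping.lookup (restrict_exponent (W k) (f k)) t"
    using assms(1,2) by (simp add: lookup_sum)
qed

text \<open>A product of nonzero ideals in disjoint variables determines its factors: a monomial of one factor
is completed by arbitrary monomials of the others to one of the product.\<close>

lemma blockwise_subset_imp:
  assumes fin: "finite I" and dis: "\<And>i j. i \<in> I \<Longrightarrow> j \<in> I \<Longrightarrow> i \<noteq> j \<Longrightarrow> W i \<inter> W j = {}"
    and up: "\<And>i. i \<in> I \<Longrightarrow> upset V (U i)" and up': "\<And>i. i \<in> I \<Longrightarrow> upset V (U' i)"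
    and supp: "\<And>i. i \<in> I \<Longrightarrow> restriction_closed (W i) (U i)"
    and ne: "\<And>i. i \<in> I \<Longrightarrow> U i \<noteq> {}"
    and sub: "blockwise V I W U \<subseteq> blockwise V I W U'" and k: "k \<in> I"
  shows "U k \<subseteq> U' k"
proof
  fix m assume m: "m \<in> U k"
  \<comment> \<open>The given monomial in block \<open>k\<close>, any monomial of the factor in the other blocks.\<close>
  define f where "f = (\<lambda>i. SOME u. u \<in> U i)(k := m)"
  have f: "f i \<in> U i" if "i \<in> I" for i
    using ne[OF that] m by (auto simp: f_def intro: someI_ex)
  let ?x = "\<Sum>j\<in>I. restrict_exponent (W j) (f j)"
  have r: "restrict_exponent (W i) ?x = restrict_exponent (W i) (f i)" if "i \<in> I" for i
    by (rule restrict_exponent_sum[OF fin that dis])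
  have "?x \<in> exponents V"
    using upset_subset[OF up f] by (auto simp: exponents_iff_lookup lookup_sum intro!: sum.neutral)
  then have "?x \<in> blockwise V I W U"
    using supp f by (auto simp: blockwise_def r restriction_closed_def)
  then have "?x \<in> blockwise V I W U'" using sub by blast
  then have "restrict_exponent (W k) ?x \<in> U' k"
    using k by (simp add: blockwise_def)
  then have "restrict_exponent (W k) m \<in> U' k"
    unfolding r[OF k] by (simp add: f_def)
  then show "m \<in> U' k"
    by (rule upset_le[OF up'[OF k]]) (auto simp: upset_subset[OF up[OF k] m])
qed

section \<open>Monomial ideals\<close>

definition monomial_ideal :: "('v \<Rightarrow>\<^sub>0 nat) set \<Rightarrow> ('v, 'k::field) mpoly set" where
  "monomial_ideal U = {p. Poly_Mapping.keys p \<subseteq> U}"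

lemma poly_ring_simps:
  "carrier (poly_ring V) = monomial_ideal (exponents V)"
  "x \<otimes>\<^bsub>poly_ring V\<^esub> y = x * y"
  "x \<oplus>\<^bsub>poly_ring V\<^esub> y = x + y"
  "\<one>\<^bsub>poly_ring V\<^esub> = 1"
  "\<zero>\<^bsub>poly_ring V\<^esub> = 0"
  by (auto simp: poly_ring_def monomial_ideal_def exponents_def)

lemma poly_ring_pow: "x [^]\<^bsub>poly_ring V\<^esub> (n::nat) = x ^ n"
  by (induction n) (simp_all add: poly_ring_simps nat_pow_def mult.commute)

lemma monomial_ideal_zero [simp]: "0 \<in> monomial_ideal U"
  and monomial_ideal_add: "p \<in> monomial_ideal U \<Longrightarrow> q \<in> monomial_ideal U \<Longrightarrow> p + q \<in> monomial_ideal U"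
  and monomial_ideal_uminus: "p \<in> monomial_ideal U \<Longrightarrow> - p \<in> monomial_ideal U"
  using Poly_Mapping.keys_add[of p q] by (auto simp: monomial_ideal_def)

lemma monomial_ideal_sum: "(\<And>i. i \<in> I \<Longrightarrow> f i \<in> monomial_ideal U) \<Longrightarrow> sum f I \<in> monomial_ideal U"
  by (induction I rule: infinite_finite_induct) (auto intro: monomial_ideal_add)

lemma monomial_ideal_mult:
  "p \<in> monomial_ideal U \<Longrightarrow> q \<in> monomial_ideal W \<Longrightarrow> p * q \<in> monomial_ideal (U + W)"
  using Poly_Mapping.keys_mult[of p q] by (fastforce simp: monomial_ideal_def set_plus_def)

lemma monomial_ideal_mono: "U \<subseteq> W \<Longrightarrow> monomial_ideal U \<subseteq> monomial_ideal W"
  by (auto simp: monomial_ideal_def)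

lemma monomial_ideal_single: "c \<noteq> 0 \<Longrightarrow> Poly_Mapping.single m c \<in> monomial_ideal U \<longleftrightarrow> m \<in> U"
  by (simp add: monomial_ideal_def)

lemma monomial_ideal_singleI: "m \<in> U \<Longrightarrow> Poly_Mapping.single m c \<in> monomial_ideal U"
  by (simp add: monomial_ideal_def)

lemma monomial_ideal_subset_iff: "(monomial_ideal U :: ('v, 'k::field) mpoly set) \<subseteq> monomial_ideal W \<longleftrightarrow> U \<subseteq> W"
proof
  assume "(monomial_ideal U :: ('v, 'k) mpoly set) \<subseteq> monomial_ideal W"
  then show "U \<subseteq> W"
    using monomial_ideal_single[of "1::'k"] by (metis subset_iff zero_neq_one)
qed (rule monomial_ideal_mono)

lemma monomial_ideal_eq_iff: "(monomial_ideal U :: ('v, 'k::field) mpoly set) = monomial_ideal W \<longleftrightarrow> U = W"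
  by (simp add: set_eq_subset monomial_ideal_subset_iff)

lemma poly_sum_single:
  "p = (\<Sum>m\<in>Poly_Mapping.keys p. Poly_Mapping.single m (Poly_Mapping.lookup p m))"
proof (rule poly_mapping_eqI)
  fix k
  have "(\<Sum>m\<in>Poly_Mapping.keys p. Poly_Mapping.lookup (Poly_Mapping.single m (Poly_Mapping.lookup p m)) k)
      = (\<Sum>m\<in>Poly_Mapping.keys p. if m = k then Poly_Mapping.lookup p m else 0)"
    by (intro sum.cong) (auto simp: lookup_single when_def)
  then show "Poly_Mapping.lookup p k = Poly_Mapping.lookup 
     (\<Sum>m\<in>Poly_Mapping.keys p. Poly_Mapping.single m (Poly_Mapping.lookup p m)) k"
    by (simp add: lookup_sum in_keys_iff)
qed

text \<open>Proof principle: a polynomial is the sum of its terms, so inclusion of a monomial ideal in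
an additively closed set needs to be checked on terms only.\<close>

lemma monomial_ideal_subset:
  fixes K :: "('v, 'k::field) mpoly set"
  assumes "\<And>m c. m \<in> U \<Longrightarrow> Poly_Mapping.single m c \<in> K"
    and "0 \<in> K" and "\<And>p q. p \<in> K \<Longrightarrow> q \<in> K \<Longrightarrow> p + q \<in> K"
  shows "monomial_ideal U \<subseteq> K"
proof
  fix p :: "('v, 'k) mpoly" assume "p \<in> monomial_ideal U"
  then have U: "Poly_Mapping.keys p \<subseteq> U" by (simp add: monomial_ideal_def)
  have "(\<Sum>m\<in>M. Poly_Mapping.single m (Poly_Mapping.lookup p m)) \<in> K" if "M \<subseteq> U" for M
    using that by (induction M rule: infinite_finite_induct) (auto intro: assms)
  then show "p \<in> K" using U poly_sum_single[of p] by metis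
qed

lemma ideal_monomial_ideal:
  assumes "upset V U"
  shows "ideal (monomial_ideal U) (poly_ring V :: ('v, 'k::field) mpoly ring)"
proof -
  interpret cring "poly_ring V :: ('v, 'k) mpoly ring" by (rule cring_poly_ring)
  have UV: "monomial_ideal U \<subseteq> (carrier (poly_ring V) :: ('v, 'k) mpoly set)"
    using assms by (auto simp: poly_ring_simps monomial_ideal_subset_iff upset_def)
  have mult: "p * q \<in> monomial_ideal U" if "p \<in> monomial_ideal U" "q \<in> monomial_ideal (exponents V)"
    for p q :: "('v, 'k) mpoly"
    using monomial_ideal_mult[OF that] upset_plus_exponents[OF assms] by simp
  show ?thesis
  proof (rule idealI)
    show "subgroup (monomial_ideal U) (add_monoid (poly_ring V :: ('v, 'k) mpoly ring))"
    proof (rule add.subgroupI)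
      fix p :: "('v, 'k) mpoly" assume p: "p \<in> monomial_ideal U"
      then have "- p \<in> monomial_ideal U" by (rule monomial_ideal_uminus)
      moreover from this have "\<ominus>\<^bsub>poly_ring V\<^esub> p = - p"
        using UV p by (intro minus_equality) (auto simp: poly_ring_simps)
      ultimately show "\<ominus>\<^bsub>poly_ring V\<^esub> p \<in> monomial_ideal U" by simp
    qed (use UV in \<open>auto simp: poly_ring_simps monomial_ideal_add intro: monomial_ideal_zero\<close>)
  qed (auto simp: poly_ring_simps mult ring_axioms mult.commute)
qed

lemma ideal_prod_monomial_ideal:
  "ideal_prod (poly_ring V :: ('v, 'k::field) mpoly ring) (monomial_ideal U) (monomial_ideal W) = monomial_ideal (U + W)"
proof
  show "ideal_prod (poly_ring V :: ('v, 'k) mpoly ring) (monomial_ideal U) (monomial_ideal W) \<subseteq> monomial_ideal (U + W)"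
  proof
    fix x assume "x \<in> ideal_prod (poly_ring V :: ('v, 'k) mpoly ring) (monomial_ideal U) (monomial_ideal W)"
    then show "x \<in> monomial_ideal (U + W)"
      by (induction rule: ideal_prod.induct) (auto simp: poly_ring_simps intro: monomial_ideal_mult monomial_ideal_add)
  qed
  have prod: "p * q \<in> ideal_prod (poly_ring V) (monomial_ideal U) (monomial_ideal W)"
    if "p \<in> monomial_ideal U" "q \<in> monomial_ideal W" for p q :: "('v, 'k) mpoly"
    using ideal_prod.prod[OF that, of "poly_ring V"] by (simp add: poly_ring_simps)
  show "monomial_ideal (U + W) \<subseteq> ideal_prod (poly_ring V :: ('v, 'k) mpoly ring) (monomial_ideal U) (monomial_ideal W)"
  proof (rule monomial_ideal_subset)
    fix m and c :: 'k assume "m \<in> U + W"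
    then obtain u w where "m = u + w" "u \<in> U" "w \<in> W" by (auto elim: set_plus_elim)
    then show "Poly_Mapping.single m c \<in> ideal_prod (poly_ring V) (monomial_ideal U) (monomial_ideal W)"
      using prod[of "Poly_Mapping.single u c" "Poly_Mapping.single w 1"]
      by (simp add: mult_single monomial_ideal_singleI)
  qed (use prod[of 0 0] ideal_prod.sum[where R = "poly_ring V"] in \<open>auto simp: poly_ring_simps\<close>)
qed

lemma ideal_pow_monomial_ideal:
  "ideal_pow (poly_ring V :: ('v, 'k::field) mpoly ring) (monomial_ideal U) n = monomial_ideal (upset_power V U n)"
  by (induction n)
    (simp_all add: nat_pow_def ideals_set_def poly_ring_simps ideal_prod_monomial_ideal)

lemma Idl_monomials:
  assumes "A \<subseteq> exponents V"
  shows "Idl\<^bsub>poly_ring V\<^esub> ((\<lambda>a. Poly_Mapping.single a 1) ` A) = (monomial_ideal (A + exponents V) :: ('v, 'k::field) mpoly set)"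
    (is "Idl\<^bsub>?S\<^esub> ?G = _")
proof -
  interpret cring ?S by (rule cring_poly_ring)
  have G: "?G \<subseteq> carrier ?S" using assms by (auto simp: poly_ring_simps monomial_ideal_singleI)
  interpret I: ideal "Idl\<^bsub>?S\<^esub> ?G" ?S by (rule genideal_ideal[OF G])
  have "a \<in> A + exponents V" if "a \<in> A" for a
    using set_plus_intro[OF that zero_in_exponents] by simp
  then have "Idl\<^bsub>?S\<^esub> ?G \<subseteq> monomial_ideal (A + exponents V)"
    by (intro genideal_minimal ideal_monomial_ideal upset_generated[OF assms])
       (auto simp: monomial_ideal_singleI)
  moreover have "monomial_ideal (A + exponents V) \<subseteq> Idl\<^bsub>?S\<^esub> ?G"
  proof (rule monomial_ideal_subset)
    fix m and c :: 'k assume "m \<in> A + exponents V"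
    then obtain a x where m: "m = a + x" "a \<in> A" "x \<in> exponents V" by (auto elim: set_plus_elim)
    have "Poly_Mapping.single a 1 \<in> Idl\<^bsub>?S\<^esub> ?G" using genideal_self[OF G] m by blast
    from I.I_l_closed[OF this, of "Poly_Mapping.single x c"] m
    show "Poly_Mapping.single m c \<in> Idl\<^bsub>?S\<^esub> ?G"
      by (simp add: poly_ring_simps mult_single monomial_ideal_singleI add.commute)
  qed (use I.zero_closed I.a_closed in \<open>auto simp: poly_ring_simps\<close>)
  ultimately show ?thesis by blast
qed

text \<open>Each step of the induction is \<open>blockwise_insert\<close>: multiplication of monomial ideals is addition of
exponent sets.\<close>

lemma finprod_monomial_ideal:
  assumes fin: "finite I" and dis: "\<And>i j. i \<in> I \<Longrightarrow> j \<in> I \<Longrightarrow> i \<noteq> j \<Longrightarrow> W i \<inter> W j = {}"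
    and up: "\<And>i. i \<in> I \<Longrightarrow> upset V (U i)"
    and supp: "\<And>i. i \<in> I \<Longrightarrow> restriction_closed (W i) (U i)"
  shows "(\<Otimes>\<^bsub>ideals_set (poly_ring V :: ('v, 'k::field) mpoly ring)\<^esub> i \<in> I. monomial_ideal (U i))
    = monomial_ideal (blockwise V I W U)"
proof -
  interpret cring "poly_ring V :: ('v, 'k) mpoly ring" by (rule cring_poly_ring)
  interpret M: comm_monoid "ideals_set (poly_ring V :: ('v, 'k) mpoly ring)"
    by (rule ideals_set_is_comm_monoid)
  show ?thesis
    using fin dis up supp
  proof (induction I)
    case empty
    have "\<one>\<^bsub>ideals_set (poly_ring V :: ('v, 'k) mpoly ring)\<^esub> = monomial_ideal (exponents V)"
      by (simp add: ideals_set_def poly_ring_simps)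
    then show ?case by (simp add: blockwise_def)
  next
    case (insert a I)
    have IH: "(\<Otimes>\<^bsub>ideals_set (poly_ring V :: ('v, 'k) mpoly ring)\<^esub> i \<in> I. monomial_ideal (U i)) = monomial_ideal (blockwise V I W U)"
      by (rule insert.IH) (use insert.prems in auto)
    have "(\<Otimes>\<^bsub>ideals_set (poly_ring V :: ('v, 'k) mpoly ring)\<^esub> i \<in> insert a I. monomial_ideal (U i))
      = monomial_ideal (U a) \<otimes>\<^bsub>ideals_set (poly_ring V)\<^esub> monomial_ideal (blockwise V I W U)"
      unfolding IH[symmetric] using insert.hyps insert.prems(2)
      by (intro M.finprod_insert) (auto simp: ideals_set_def intro!: ideal_monomial_ideal)
    also have "\<dots> = monomial_ideal (U a + blockwise V I W U)"
      by (simp add: ideals_set_def ideal_prod_monomial_ideal)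
    also have "U a + blockwise V I W U = blockwise V (insert a I) W U"
      by (rule blockwise_insert[symmetric]) (use insert in \<open>auto simp: disjoint_iff\<close>)
    finally show ?case .
  qed
qed

lemma (in comm_monoid) finprod_nat_pow:
  assumes "f \<in> I \<rightarrow> carrier G"
  shows "(\<Otimes>i\<in>I. f i) [^] (n::nat) = (\<Otimes>i\<in>I. f i [^] n)"
proof (induction n)
  case (Suc n)
  have "(\<Otimes>i\<in>I. f i [^] n \<otimes> f i) = (\<Otimes>i\<in>I. f i [^] n) \<otimes> (\<Otimes>i\<in>I. f i)"
    using assms by (intro finprod_multf) auto
  with Suc show ?case by simp
qed simp

text \<open>A statement about exponents only, whose combinatorial proof would have to distribute an \<open>n\<close>-fold
sum over all blocks. In the commutative monoid of ideals it is the rule that the power of a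
product is the product of the powers; any coefficient field serves to transport it, for
instance the rational numbers.\<close>

lemma upset_power_blockwise:
  fixes V :: "'v set"
  assumes fin: "finite I" and dis: "\<And>i j. i \<in> I \<Longrightarrow> j \<in> I \<Longrightarrow> i \<noteq> j \<Longrightarrow> W i \<inter> W j = {}"
    and up: "\<And>i. i \<in> I \<Longrightarrow> upset V (U i)"
    and supp: "\<And>i. i \<in> I \<Longrightarrow> restriction_closed (W i) (U i)"
  shows "upset_power V (blockwise V I W U) n = blockwise V I W (\<lambda>i. upset_power V (U i) n)"
proof -
  let ?S = "poly_ring V :: ('v, rat) mpoly ring"
  interpret cring ?S by (rule cring_poly_ring)
  interpret M: comm_monoid "ideals_set ?S"
    by (rule ideals_set_is_comm_monoid)
  have prod: "monomial_ideal (blockwise V I W U) = (\<Otimes>\<^bsub>ideals_set ?S\<^esub> i \<in> I. monomial_ideal (U i))"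
    by (rule finprod_monomial_ideal[OF assms, symmetric])
  have "monomial_ideal (upset_power V (blockwise V I W U) n) = ideal_pow ?S (monomial_ideal (blockwise V I W U)) n"
    by (simp add: ideal_pow_monomial_ideal)
  also have "\<dots> = (\<Otimes>\<^bsub>ideals_set ?S\<^esub> i \<in> I. ideal_pow ?S (monomial_ideal (U i)) n)"
    unfolding prod by (rule M.finprod_nat_pow) (auto simp: ideals_set_def intro: ideal_monomial_ideal up)
  also have "\<dots> = monomial_ideal (blockwise V I W (\<lambda>i. upset_power V (U i) n))"
    unfolding ideal_pow_monomial_ideal
    by (rule finprod_monomial_ideal) (use assms in \<open>auto intro: upset_upset_power restriction_closed_upset_power\<close>)
  finally show ?thesis by (simp add: monomial_ideal_eq_iff)
qed

text \<open>Each block comes with its own multiplier \<open>l i\<close>; the product of all of them works for every block.\<close>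

lemma newton_closure_blockwise:
  assumes fin: "finite I" and dis: "\<And>i j. i \<in> I \<Longrightarrow> j \<in> I \<Longrightarrow> i \<noteq> j \<Longrightarrow> W i \<inter> W j = {}"
    and up: "\<And>i. i \<in> I \<Longrightarrow> upset V (U i)"
    and supp: "\<And>i. i \<in> I \<Longrightarrow> restriction_closed (W i) (U i)"
  shows "newton_closure V (blockwise V I W U) = blockwise V I W (\<lambda>i. newton_closure V (U i))"
proof (intro equalityI subsetI)
  fix m assume "m \<in> newton_closure V (blockwise V I W U)"
  then obtain l where "m \<in> exponents V" "l \<ge> 1"
    and l: "scale l m \<in> blockwise V I W (\<lambda>i. upset_power V (U i) l)"
    by (auto simp: newton_closure_def upset_power_blockwise[OF assms])
  moreover have "scale l (restrict_exponent (W i) m) \<in> upset_power V (U i) l" if "i \<in> I" for i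
    using l that by (auto simp: blockwise_def restrict_exponent_scale)
  ultimately show "m \<in> blockwise V I W (\<lambda>i. newton_closure V (U i))"
    by (auto simp: blockwise_def newton_closure_def exponents_restrict)
next
  fix m assume m: "m \<in> blockwise V I W (\<lambda>i. newton_closure V (U i))"
  then have "\<forall>i\<in>I. \<exists>l\<ge>1. scale l (restrict_exponent (W i) m) \<in> upset_power V (U i) l"
    by (auto simp: blockwise_def newton_closure_def)
  then obtain l where l: "\<And>i. i \<in> I \<Longrightarrow> l i \<ge> 1 \<and> scale (l i) (restrict_exponent (W i) m) \<in> upset_power V (U i) (l i)"
    by metis
  have "scale (prod l I) (restrict_exponent (W i) m) \<in> upset_power V (U i) (prod l I)" if "i \<in> I" for i
  proof -
    have "prod l I = l i * prod l (I - {i})" using fin that by (rule prod.remove)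
    then show ?thesis
      using scale_in_upset_power[of "scale (l i) (restrict_exponent (W i) m)" "upset_power V (U i) (l i)" "prod l (I - {i})" V] l[OF that]
      by (simp add: upset_power_mult up that scale_scale mult.commute)
  qed
  moreover have "prod l I \<ge> 1"
    using l fin by (simp add: Suc_le_eq prod_pos)
  moreover have "m \<in> exponents V" using m by (simp add: blockwise_def)
  ultimately have "scale (prod l I) m \<in> blockwise V I W (\<lambda>i. upset_power V (U i) (prod l I))"
    by (simp add: blockwise_def exponents_scale restrict_exponent_scale)
  then have "scale (prod l I) m \<in> upset_power V (blockwise V I W U) (prod l I)"
    by (subst upset_power_blockwise[OF assms])
  with \<open>prod l I \<ge> 1\<close> \<open>m \<in> exponents V\<close> show "m \<in> newton_closure V (blockwise V I W U)"
    unfolding newton_closure_def by blast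
qed

section \<open>Dickson's lemma\<close>

lemma nat_mono_subseq:
  fixes s :: "nat \<Rightarrow> nat"
  shows "\<exists>\<phi> :: nat \<Rightarrow> nat. strict_mono \<phi> \<and> mono (s \<circ> \<phi>)"
proof -
  obtain f where f: "strict_mono f" "monoseq (\<lambda>n. s (f n))" using seq_monosub by blast
  show ?thesis
  proof (cases "\<forall>m n. m \<le> n \<longrightarrow> s (f m) \<le> s (f n)")
    case True
    then show ?thesis using f(1) by (intro exI[of _ f]) (auto simp: mono_def)
  next
    case False
    then have dec: "s (f n) \<le> s (f m)" if "m \<le> n" for m n 
      using f(2) that by (auto simp: monoseq_def)
    obtain k where k: "\<And>n. s (f k) \<le> s (f n)"
      using ex_has_least_nat[of "\<lambda>_. True" _ "\<lambda>n. s (f n)"] by blast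
    have "s (f (k + n)) = s (f k)" for n
      using k[of "k + n"] dec[of k "k + n"] by simp
    moreover have "strict_mono (\<lambda>n. f (k + n))"
      using f(1) by (simp add: strict_mono_def)
    ultimately show ?thesis by (intro exI[of _ "\<lambda>n. f (k + n)"]) (auto simp: mono_def)
  qed
qed

text \<open>Passing to a subsequence once for each coordinate; as a consequence, any infinite sequence of
vectors of natural numbers contains two comparable ones.\<close>

lemma Dickson_subseq:
  fixes s :: "nat \<Rightarrow> 'i \<Rightarrow> nat"
  assumes "finite I"
  shows "\<exists>\<phi> :: nat \<Rightarrow> nat. strict_mono \<phi> \<and> (\<forall>i\<in>I. mono (\<lambda>n. s (\<phi> n) i))"
  using assms
proof (induction I)
  case empty
  then show ?case using strict_mono_id by (auto intro: exI[of _ id])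
next
  case (insert a I)
  then obtain \<phi> :: "nat \<Rightarrow> nat" where \<phi>: "strict_mono \<phi>" "\<And>i. i \<in> I \<Longrightarrow> mono (\<lambda>n. s (\<phi> n) i)" by blast
  obtain \<psi> :: "nat \<Rightarrow> nat" where \<psi>: "strict_mono \<psi>" "mono ((\<lambda>n. s (\<phi> n) a) \<circ> \<psi>)"
    using nat_mono_subseq by blast
  have "mono (\<lambda>n. s ((\<phi> \<circ> \<psi>) n) i)" if "i \<in> insert a I" for i
  proof (cases "i = a")
    case True
    then show ?thesis using \<psi>(2) by (simp add: comp_def)
  next
    case False
    then show ?thesis using \<phi>(2)[of i] that strict_mono_mono[OF \<psi>(1)] by (auto simp: mono_def)
  qed
  then show ?case using strict_mono_o[OF \<phi>(1) \<psi>(1)] by blast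
qed

text \<open>The minimal elements of \<open>U\<close> generate it. Infinitely many of them would contain two distinct
comparable ones.\<close>

lemma upset_finitely_generated:
  fixes V :: "'v set"
  assumes V: "finite V" and U: "upset V U"
  obtains A where "finite A" "A \<subseteq> U" "U = A + exponents V"
proof -
  define le where "le = (\<lambda>w u :: 'v \<Rightarrow>\<^sub>0 nat. \<forall>t. Poly_Mapping.lookup w t \<le> Poly_Mapping.lookup u t)"
  define A where "A = {u \<in> U. \<forall>w\<in>U. le w u \<longrightarrow> w = u}"
  have "finite A"
  proof (rule ccontr)
    assume "infinite A"
    then obtain s :: "nat \<Rightarrow> 'v \<Rightarrow>\<^sub>0 nat" where s: "inj s" "range s \<subseteq> A"
      using infinite_countable_subset by blast
    obtain \<phi> :: "nat \<Rightarrow> nat" where \<phi>: "strict_mono \<phi>" "\<And>t. t \<in> V \<Longrightarrow> mono (\<lambda>n. Poly_Mapping.lookup (s (\<phi> n)) t)"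
      using Dickson_subseq[OF V, of "\<lambda>n. Poly_Mapping.lookup (s n)"] by blast
    have "Poly_Mapping.lookup (s (\<phi> 0)) t \<le> Poly_Mapping.lookup (s (\<phi> 1)) t" for t
    proof (cases "t \<in> V")
      case True
      then show ?thesis using \<phi>(2)[of t] by (simp add: mono_def)
    next
      case False
      have "s n \<in> exponents V" for n using s(2) upset_subset[OF U] by (auto simp: A_def)
      then show ?thesis using False by (simp add: exponents_iff_lookup)
    qed
    then have "le (s (\<phi> 0)) (s (\<phi> 1))" by (simp add: le_def)
    moreover have "s n \<in> A" for n using s(2) by blast
    ultimately have "s (\<phi> 0) = s (\<phi> 1)" by (auto simp: A_def)
    then have "\<phi> 0 = \<phi> 1" by (rule injD[OF s(1)])
    then show False using strict_monoD[OF \<phi>(1), of 0 1] by simp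
  qed
  moreover have "A \<subseteq> U" by (auto simp: A_def)
  moreover have "U = A + exponents V"
  proof
    show "A + exponents V \<subseteq> U"
      using U by (auto simp: A_def upset_def elim!: set_plus_elim)
    show "U \<subseteq> A + exponents V"
    proof
      fix u assume u: "u \<in> U"
      let ?d = "\<lambda>w. \<Sum>t\<in>V. Poly_Mapping.lookup w t"
      obtain w where w: "w \<in> U" "le w u" and min: "\<And>y. y \<in> U \<Longrightarrow> le y u \<Longrightarrow> ?d w \<le> ?d y"
        using ex_has_least_nat[of "\<lambda>w. w \<in> U \<and> le w u" u ?d] u by (auto simp: le_def)
      have "y = w" if y: "y \<in> U" "le y w" for y
      proof (rule poly_mapping_eqI)
        fix t
        have "?d w \<le> ?d y" using y w by (intro min) (auto simp: le_def intro: order_trans)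
        moreover have "?d y \<le> ?d w" using y by (intro sum_mono) (auto simp: le_def)
        ultimately have "?d y = ?d w" by simp
        then have "\<forall>t\<in>V. Poly_Mapping.lookup y t = Poly_Mapping.lookup w t"
          using sum_mono_inv[OF _ _ _ V, of "Poly_Mapping.lookup y" "Poly_Mapping.lookup w"] y
          by (auto simp: le_def)
        moreover have "y \<in> exponents V" "w \<in> exponents V" using U y w by (auto simp: upset_def)
        ultimately show "Poly_Mapping.lookup y t = Poly_Mapping.lookup w t"
          by (cases "t \<in> V") (auto simp: exponents_iff_lookup)
      qed
      then have "w \<in> A" using w by (auto simp: A_def)
      moreover have "u - w \<in> exponents V" using upset_subset[OF U u] by (rule exponents_diff)
      moreover have "u = w + (u - w)"
        using w by (intro poly_mapping_eqI) (auto simp: le_def lookup_add lookup_minus)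
      ultimately show "u \<in> A + exponents V" by (metis set_plus_intro)
    qed
  qed
  ultimately show ?thesis by (rule that)
qed

section \<open>Sums of generators\<close>

text \<open>Multiplicities \<open>\<alpha>\<close> record how often each generator occurs in a sum. They can be compared and
subtracted, which the bare sums do not allow.\<close>

definition combination :: "('v \<Rightarrow>\<^sub>0 nat) set \<Rightarrow> (('v \<Rightarrow>\<^sub>0 nat) \<Rightarrow> nat) \<Rightarrow> ('v \<Rightarrow>\<^sub>0 nat)" where
  "combination B \<alpha> = (\<Sum>u\<in>B. scale (\<alpha> u) u)"

definition fold_sums :: "('v \<Rightarrow>\<^sub>0 nat) set \<Rightarrow> nat \<Rightarrow> ('v \<Rightarrow>\<^sub>0 nat) set" where
  "fold_sums B n = {combination B \<alpha> | \<alpha>. sum \<alpha> B = n}"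

lemma combination_in_fold_sums: "sum \<alpha> B = n \<Longrightarrow> combination B \<alpha> \<in> fold_sums B n"
  by (auto simp: fold_sums_def)

lemma combination_split:
  assumes "finite B" "a \<in> B" "k \<le> \<alpha> a"
  shows "combination B \<alpha> = scale k a + combination B (\<alpha>(a := \<alpha> a - k))"
    and "sum \<alpha> B = k + sum (\<alpha>(a := \<alpha> a - k)) B"
proof -
  have "(\<Sum>u\<in>B - {a}. scale ((\<alpha>(a := \<alpha> a - k)) u) u) = (\<Sum>u\<in>B - {a}. scale (\<alpha> u) u)"
    by (rule sum.cong) auto
  then show "combination B \<alpha> = scale k a + combination B (\<alpha>(a := \<alpha> a - k))"
    using assms
    by (simp add: combination_def sum.remove[OF assms(1,2)] add.assoc[symmetric] scale_add_left[symmetric])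
  have "sum (\<alpha>(a := \<alpha> a - k)) (B - {a}) = sum \<alpha> (B - {a})"
    by (rule sum.cong) auto
  then show "sum \<alpha> B = k + sum (\<alpha>(a := \<alpha> a - k)) B"
    using assms by (simp add: sum.remove[OF assms(1,2)])
qed

lemma fold_sums_0: "finite B \<Longrightarrow> fold_sums B 0 = {0}"
  by (auto simp: fold_sums_def combination_def intro!: exI[of _ "\<lambda>_. 0"])

lemma fold_sums_add: "x \<in> fold_sums B m \<Longrightarrow> y \<in> fold_sums B n \<Longrightarrow> x + y \<in> fold_sums B (m + n)"
proof -
  assume "x \<in> fold_sums B m" "y \<in> fold_sums B n"
  then obtain \<alpha> \<beta> where "x = combination B \<alpha>" "y = combination B \<beta>" "sum \<alpha> B = m" "sum \<beta> B = n"
    by (auto simp: fold_sums_def)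
  then show ?thesis
    by (auto simp: fold_sums_def combination_def scale_add_left sum.distrib intro!: exI[of _ "\<lambda>u. \<alpha> u + \<beta> u"])
qed

lemma fold_sums_scale:
  assumes "finite B" "a \<in> B" shows "scale n a \<in> fold_sums B n"
proof -
  have "(\<Sum>u\<in>B. scale (if u = a then n else 0) u) = (\<Sum>u\<in>B. if u = a then scale n a else 0)"
    by (rule sum.cong) auto
  then show ?thesis using assms
    by (auto simp: fold_sums_def combination_def intro!: exI[of _ "\<lambda>u. if u = a then n else 0"])
qed

lemma fold_sums_Suc:
  assumes B: "finite B" shows "fold_sums B (Suc n) = B + fold_sums B n"
proof (intro equalityI subsetI)
  fix x assume "x \<in> fold_sums B (Suc n)"
  then obtain \<alpha> where x: "x = combination B \<alpha>" "sum \<alpha> B = Suc n" by (auto simp: fold_sums_def)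
  then obtain a where a: "a \<in> B" "1 \<le> \<alpha> a" by (metis One_nat_def Suc_leI gr0I old.nat.distinct(1) sum.neutral)
  note combination_split[where \<alpha> = \<alpha>, OF B a]
  then have "x = a + combination B (\<alpha>(a := \<alpha> a - 1))" "sum (\<alpha>(a := \<alpha> a - 1)) B = n" using x by simp_all
  then show "x \<in> B + fold_sums B n" using a(1) by (force simp: fold_sums_def intro: set_plus_intro)
next
  fix x assume "x \<in> B + fold_sums B n"
  then show "x \<in> fold_sums B (Suc n)"
    using fold_sums_add[of _ B 1 _ n] fold_sums_scale[OF B, of _ 1] by (auto elim!: set_plus_elim)
qed

lemma finite_fold_sums: "finite B \<Longrightarrow> finite (fold_sums B n)"
  by (induction n) (simp_all add: fold_sums_0 fold_sums_Suc finite_set_plus)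

lemma fold_sums_mono: 
  assumes "finite B" "A \<subseteq> B" shows "fold_sums A n \<subseteq> fold_sums B n"
  using assms finite_subset[OF assms(2,1)]
  by (induction n) (simp_all add: fold_sums_0 fold_sums_Suc set_plus_mono2)

lemma upset_power_generated:
  assumes "finite A" shows "upset_power V (A + exponents V) n = fold_sums A n + exponents V"
proof (induction n)
  case (Suc n)
  have "exponents V + exponents V = exponents V" by (rule upset_plus_exponents) simp
  then have "upset_power V (A + exponents V) (Suc n) = A + fold_sums A n + exponents V"
    using Suc by simp (metis ab_semigroup_add_class.add_ac(1) add.commute)
  then show ?case by (simp only: fold_sums_Suc[OF assms])
qed (simp add: fold_sums_0[OF assms])

text \<open>The loss of a constant number \<open>c\<close> of factors can be repaired. Write \<open>N m\<close> as a sum of \<open>N - c\<close> generators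
and a remainder. By Dickson's lemma there are \<open>N < N'\<close> such that all multiplicities and the
remainder grow from \<open>N\<close> to \<open>N'\<close>; the difference of the two expressions writes \<open>(N' - N) m\<close> with
exactly \<open>N' - N\<close> generators, because \<open>c\<close> cancels.\<close>

lemma almost_power_imp_newton_closure:
  assumes V: "finite V" and U: "upset V U" and m: "m \<in> exponents V"
    and almost: "\<And>N. scale N m \<in> upset_power V U (N - c)"
  shows "m \<in> newton_closure V U"
proof -
  obtain A where A: "finite A" "A \<subseteq> U" "U = A + exponents V"
    using upset_finitely_generated[OF V U] .
  have "\<exists>\<alpha> x. x \<in> exponents V \<and> sum \<alpha> A = N - c \<and> scale N m = combination A \<alpha> + x" for N
    using almost[of N] unfolding A(3) upset_power_generated[OF A(1)] by (auto simp: fold_sums_def elim!: set_plus_elim)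
  then obtain \<alpha> x where x: "\<And>N. x N \<in> exponents V" and \<alpha>: "\<And>N. sum (\<alpha> N) A = N - c"
    and eq: "\<And>N. scale N m = combination A (\<alpha> N) + x N"
    by metis
  \<comment> \<open>One vector of natural numbers holds the multiplicities (left summand) and the remainder (right summand).\<close>
  obtain \<phi> :: "nat \<Rightarrow> nat" where \<phi>: "strict_mono \<phi>"
    and mono: "\<And>i. i \<in> A <+> V \<Longrightarrow> mono (\<lambda>n. case_sum (\<alpha> (\<phi> n)) (Poly_Mapping.lookup (x (\<phi> n))) i)"
    using Dickson_subseq[of "A <+> V" "\<lambda>n. case_sum (\<alpha> n) (Poly_Mapping.lookup (x n))"] A(1) V
    by auto
  \<comment> \<open>Starting at the index \<open>c\<close> ensures \<open>c \<le> N\<close>, so that \<open>N - c\<close> and \<open>N' - c\<close> are true differences.\<close>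
  define N where "N = \<phi> c"
  define N' where "N' = \<phi> (Suc c)"
  have N: "c \<le> N" "N < N'" using seq_suble[OF \<phi>, of c] \<phi> by (auto simp: N_def N'_def strict_mono_def)
  have \<alpha>le: "\<alpha> N u \<le> \<alpha> N' u" if "u \<in> A" for u
    using monoD[OF mono[OF InlI], of u c "Suc c"] that by (simp add: N_def N'_def)
  have xle: "Poly_Mapping.lookup (x N) t \<le> Poly_Mapping.lookup (x N') t" for t
  proof (cases "t \<in> V")
    case True
    then show ?thesis using monoD[OF mono[OF InrI], of t c "Suc c"] by (simp add: N_def N'_def)
  next
    case False
    then show ?thesis using x by (auto simp: exponents_iff_lookup)
  qed
  define \<beta> where "\<beta> = (\<lambda>u. \<alpha> N' u - \<alpha> N u)"
  have \<beta>: "sum \<beta> A = N' - N"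
    using \<alpha>[of N] \<alpha>[of N'] N \<alpha>le by (simp add: \<beta>_def sum_subtractf_nat)
  have "scale (N' - N) m = combination A \<beta> + (x N' - x N)"
  proof (rule poly_mapping_eqI)
    fix t
    have c: "Poly_Mapping.lookup (combination A \<gamma>) t = (\<Sum>u\<in>A. \<gamma> u * Poly_Mapping.lookup u t)" for \<gamma>
      by (simp add: combination_def lookup_sum)
    have "(\<Sum>u\<in>A. \<beta> u * Poly_Mapping.lookup u t) + (\<Sum>u\<in>A. \<alpha> N u * Poly_Mapping.lookup u t)
        = (\<Sum>u\<in>A. \<alpha> N' u * Poly_Mapping.lookup u t)"
      unfolding sum.distrib[symmetric] \<beta>_def
      by (rule sum.cong) (auto simp: \<alpha>le distrib_right[symmetric])
    moreover have "N * Poly_Mapping.lookup m t = (\<Sum>u\<in>A. \<alpha> N u * Poly_Mapping.lookup u t) + Poly_Mapping.lookup (x N) t"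
      "N' * Poly_Mapping.lookup m t = (\<Sum>u\<in>A. \<alpha> N' u * Poly_Mapping.lookup u t) + Poly_Mapping.lookup (x N') t"
      using arg_cong[OF eq, of "\<lambda>p. Poly_Mapping.lookup p t"] by (simp_all add: lookup_add c)
    ultimately show "Poly_Mapping.lookup (scale (N' - N) m) t = Poly_Mapping.lookup (combination A \<beta> + (x N' - x N)) t"
      using xle[of t] by (simp add: lookup_add lookup_minus c diff_mult_distrib)
  qed
  moreover have "combination A \<beta> \<in> fold_sums A (N' - N)" using \<beta> by (auto simp: fold_sums_def)
  moreover have "x N' - x N \<in> exponents V" using x by (rule exponents_diff)
  ultimately have "scale (N' - N) m \<in> upset_power V U (N' - N)"
    unfolding A(3) upset_power_generated[OF A(1)] by (simp add: set_plus_intro)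
  then show ?thesis using m N by (auto simp: newton_closure_def intro!: exI[of _ "N' - N"])
qed

text \<open>The combinatorial form of a reduction: the monomials of \<open>M\<close> generate a module over the polynomial
ring which every monomial of \<open>F\<close> maps into its multiple by the ideal of \<open>U\<close>. For \<open>M\<close> serve the
\<open>E\<close>-fold sums of generators of \<open>U\<close> and elements of \<open>F\<close>, with \<open>E\<close> so large that a sum of \<open>E + 1\<close>
elements of \<open>F\<close> repeats some \<open>m\<close> at least \<open>l m\<close> times; these copies are traded for generators of
\<open>U\<close>.\<close>

lemma newton_closure_exchange:
  assumes V: "finite V" and U: "upset V U" and F: "finite F" "F \<subseteq> newton_closure V U" "F \<noteq> {}"
  obtains M where "finite M" "M \<noteq> {}" "F + M \<subseteq> U + M"
proof -
  obtain A where A: "finite A" "A \<subseteq> U" "U = A + exponents V"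
    using upset_finitely_generated[OF V U] .
  have AU: "a + x \<in> U" if "a \<in> A" "x \<in> exponents V" for a x using that A by auto
  have "\<forall>m\<in>F. \<exists>l\<ge>1. scale l m \<in> upset_power V U l" using F by (auto simp: newton_closure_def)
  then obtain l where l: "\<And>m. m \<in> F \<Longrightarrow> l m \<ge> 1" "\<And>m. m \<in> F \<Longrightarrow> scale (l m) m \<in> upset_power V U (l m)"
    by metis
  define B where "B = A \<union> F"
  \<comment> \<open>If every \<open>m \<in> F\<close> occurs fewer than \<open>l m\<close> times, there are at most \<open>E\<close> occurrences in total.\<close>
  define E where "E = sum l F"
  have B: "finite B" "A \<subseteq> B" using A F by (auto simp: B_def)
  have "w \<in> U + fold_sums B E" if w: "w \<in> fold_sums B (Suc E)" for w
  proof -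
    obtain \<alpha> where \<alpha>: "w = combination B \<alpha>" "sum \<alpha> B = Suc E" using w by (auto simp: fold_sums_def)
    show ?thesis
    proof (cases "\<exists>a\<in>A. 1 \<le> \<alpha> a")
      case True
      then obtain a where a: "a \<in> A" "1 \<le> \<alpha> a" by blast
      note sp = combination_split[where \<alpha> = \<alpha>, OF B(1) _ a(2)]
      have "combination B (\<alpha>(a := \<alpha> a - 1)) \<in> fold_sums B E"
        by (rule combination_in_fold_sums) (use sp(2) \<alpha> a B in auto)
      then show ?thesis using sp(1) \<alpha> a B A by (auto simp: subset_iff)
    next
      case False
      have "\<exists>m\<in>F. l m \<le> \<alpha> m"
      proof (rule ccontr)
        assume "\<not> ?thesis"
        then have "sum \<alpha> F \<le> E" unfolding E_def by (intro sum_mono) auto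
        moreover have "sum \<alpha> B = sum \<alpha> F" 
          using False B by (intro sum.mono_neutral_right) (auto simp: B_def)
        ultimately show False using \<alpha> by simp
      qed
      then obtain m where m: "m \<in> F" "l m \<le> \<alpha> m" by blast
      obtain k where k: "l m = Suc k" using l(1)[OF m(1)] by (cases "l m") auto
      define r where "r = combination B (\<alpha>(m := \<alpha> m - l m))"
      note sp = combination_split[where \<alpha> = \<alpha>, OF B(1) _ m(2)]
      have mB: "m \<in> B" using m by (simp add: B_def)
      have r: "r \<in> fold_sums B (Suc E - l m)" using sp(2)[OF mB] \<alpha> by (auto simp: r_def fold_sums_def)
      have "scale (l m) m \<in> A + fold_sums A k + exponents V" 
        using l(2)[OF m(1)] unfolding A(3) upset_power_generated[OF A(1)] k fold_sums_Suc[OF A(1)] .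
      \<comment> \<open>The \<open>l m\<close> copies of \<open>m\<close> become \<open>l m\<close> generators and a rest \<open>x\<close>. One generator takes \<open>x\<close> and leaves the sum.\<close>
      then obtain a b x where s: "scale (l m) m = (a + b) + x" "a \<in> A" "b \<in> fold_sums A k" "x \<in> exponents V"
        by (auto elim!: set_plus_elim)
      have "l m \<le> E" unfolding E_def using F m by (intro member_le_sum) auto
      then have "k + (Suc E - l m) = E" using k by simp
      then have "b + r \<in> fold_sums B E"
        using fold_sums_add[of b B k r "Suc E - l m"] r s fold_sums_mono[OF B] by auto
      moreover have "w = (a + x) + (b + r)"
        using sp(1)[OF mB] \<alpha> s by (simp add: r_def ac_simps)
      ultimately show ?thesis using AU[OF s(2,4)] by auto
    qed
  qed
  moreover have "F + fold_sums B E \<subseteq> fold_sums B (Suc E)"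
    unfolding fold_sums_Suc[OF B(1)] by (rule set_plus_mono2) (auto simp: B_def)
  moreover have "fold_sums B E \<noteq> {}"
    using fold_sums_scale[OF B(1)] F by (auto simp: B_def)
  ultimately show ?thesis using finite_fold_sums[OF B(1)] that by blast
qed

section \<open>Integral equations over a monomial ideal\<close>

lemma finsum_poly_ring:
  fixes f :: "'i \<Rightarrow> ('v, 'k::field) mpoly"
  assumes "\<And>i. i \<in> I \<Longrightarrow> f i \<in> monomial_ideal (exponents V)"
  shows "(\<Oplus>\<^bsub>poly_ring V\<^esub>i\<in>I. f i) = sum f I"
proof -
  interpret cring "poly_ring V :: ('v, 'k) mpoly ring" by (rule cring_poly_ring)
  show ?thesis
    using assms
    by (induction I rule: infinite_finite_induct) (auto simp: poly_ring_simps Pi_def)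
qed

lemma exponents_plus_exponents: "exponents V + exponents V = exponents V"
  by (rule upset_plus_exponents) simp

lemma exponents_power_closed: "p \<in> monomial_ideal (exponents V) \<Longrightarrow> p ^ n \<in> monomial_ideal (exponents V)"
  using monomial_ideal_mult[of p "exponents V" _ "exponents V"]
  by (induction n) (auto simp: exponents_plus_exponents monomial_ideal_def)

lemma monomial_ideal_upset: "upset V U \<Longrightarrow> p \<in> monomial_ideal U \<Longrightarrow> p \<in> monomial_ideal (exponents V)"
  by (auto simp: monomial_ideal_def upset_def)

text \<open>The equation of integral dependence with its ring operations read as those of the type of
all polynomials.\<close>

lemma integral_closure_monomial_ideal_iff:
  fixes x :: "('v, 'k::field) mpoly"
  assumes U: "upset V U"
  shows "x \<in> integral_closure (poly_ring V) (monomial_ideal U) \<longleftrightarrow> x \<in> monomial_ideal (exponents V) \<and>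
    (\<exists>l\<ge>1. \<exists>a. (\<forall>i\<in>{1..l}. a i \<in> monomial_ideal (upset_power V U i)) \<and> x ^ l + (\<Sum>i=1..l. a i * x ^ (l - i)) = 0)"
proof -
  have "(\<Oplus>\<^bsub>poly_ring V\<^esub>i\<in>{1..l}. a i * x ^ (l - i)) = (\<Sum>i=1..l. a i * x ^ (l - i))"
    if x: "x \<in> monomial_ideal (exponents V)" and a: "\<forall>i\<in>{1..l}. a i \<in> monomial_ideal (upset_power V U i)" for l :: nat and a
  proof (rule finsum_poly_ring)
    fix i assume "i \<in> {1..l}"
    then have "a i \<in> monomial_ideal (exponents V)"
      using monomial_ideal_upset[OF upset_upset_power[OF U]] a by blast
    from monomial_ideal_mult[OF this exponents_power_closed[OF x]]
    show "a i * x ^ (l - i) \<in> monomial_ideal (exponents V)" by (simp add: exponents_plus_exponents)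
  qed
  note sums = this
  have unfolded: "x \<in> integral_closure (poly_ring V) (monomial_ideal U) \<longleftrightarrow> x \<in> monomial_ideal (exponents V) \<and>
    (\<exists>l a. 1 \<le> l \<and> (\<forall>i\<in>{1..l}. a i \<in> monomial_ideal (upset_power V U i)) \<and>
      x ^ l + (\<Oplus>\<^bsub>poly_ring V\<^esub>i\<in>{1..l}. a i * x ^ (l - i)) = 0)"
    by (simp only: integral_closure_def ideal_pow_monomial_ideal poly_ring_simps poly_ring_pow mem_Collect_eq)
  show ?thesis
  proof
    assume "x \<in> integral_closure (poly_ring V) (monomial_ideal U)"
    then obtain l a where *: "x \<in> monomial_ideal (exponents V)" "1 \<le> l" "\<forall>i\<in>{1..l}. a i \<in> monomial_ideal (upset_power V U i)"
      "x ^ l + (\<Oplus>\<^bsub>poly_ring V\<^esub>i\<in>{1..l}. a i * x ^ (l - i)) = 0"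
      unfolding unfolded by blast
    show "x \<in> monomial_ideal (exponents V) \<and> (\<exists>l\<ge>1. \<exists>a. (\<forall>i\<in>{1..l}. a i \<in> monomial_ideal (upset_power V U i)) \<and>
        x ^ l + (\<Sum>i=1..l. a i * x ^ (l - i)) = 0)"
      using * unfolding sums[OF *(1,3)] by blast
  next
    assume "x \<in> monomial_ideal (exponents V) \<and> (\<exists>l\<ge>1. \<exists>a. (\<forall>i\<in>{1..l}. a i \<in> monomial_ideal (upset_power V U i)) \<and>
        x ^ l + (\<Sum>i=1..l. a i * x ^ (l - i)) = 0)"
    then obtain l a where *: "x \<in> monomial_ideal (exponents V)" "1 \<le> l" "\<forall>i\<in>{1..l}. a i \<in> monomial_ideal (upset_power V U i)"
      "x ^ l + (\<Sum>i=1..l. a i * x ^ (l - i)) = 0"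
      by blast
    show "x \<in> integral_closure (poly_ring V) (monomial_ideal U)"
      unfolding unfolded using *(1-3) *(4)[folded sums[OF *(1,3)]] by blast
  qed
qed

lemma monomial_ideal_mpow_mult:
  assumes "upset V U" "p \<in> monomial_ideal (upset_power V U a)" "q \<in> monomial_ideal (upset_power V U b)" "c \<le> a + b"
  shows "p * q \<in> monomial_ideal (upset_power V U c)"
  using monomial_ideal_mult[OF assms(2,3)] monomial_ideal_mono[OF upset_power_antimono[OF assms(1,4)]]
  by (auto simp: upset_power_add[OF assms(1)])

section \<open>Almost integral polynomials\<close>

text \<open>The \<open>N\<close>-th power lies in the \<open>N\<close>-th power of the ideal up to a loss of \<open>c\<close> factors that does not depend on
\<open>N\<close>. Unlike the equation of integral dependence, this condition is visibly closed under sums and can be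
read off from single monomials.\<close>

definition almost_integral :: "'v set \<Rightarrow> ('v \<Rightarrow>\<^sub>0 nat) set \<Rightarrow> ('v, 'k::field) mpoly \<Rightarrow> bool" where
  "almost_integral V U x \<longleftrightarrow> (\<exists>c. \<forall>N. x ^ N \<in> monomial_ideal (upset_power V U (N - c)))"

text \<open>The equation of degree \<open>l\<close> rewrites \<open>x\<^sup>N\<close> in terms of lower powers, each missing power being replaced by
a factor from the ideal. This works as long as \<open>N \<ge> l\<close>, so at most \<open>l\<close> factors are lost.\<close>

lemma integral_imp_almost_integral:
  fixes x :: "('v, 'k::field) mpoly"
  assumes U: "upset V U" and x: "x \<in> integral_closure (poly_ring V) (monomial_ideal U)"
  shows "almost_integral V U x"
proof -
  obtain l a where xc: "x \<in> monomial_ideal (exponents V)" and a: "\<And>i. i \<in> {1..l} \<Longrightarrow> a i \<in> monomial_ideal (upset_power V U i)"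
    and eq: "x ^ l + (\<Sum>i=1..l. a i * x ^ (l - i)) = 0"
    using x unfolding integral_closure_monomial_ideal_iff[OF U] by blast
  have "x ^ N \<in> monomial_ideal (upset_power V U (N - l))" for N
  proof (induction N rule: less_induct)
    case (less N)
    show ?case
    proof (cases "N < l")
      case True
      then show ?thesis using exponents_power_closed[OF xc] by simp
    next
      case False
      have "x ^ N = x ^ l * x ^ (N - l)" using False by (simp add: power_add[symmetric])
      also have "x ^ l = - (\<Sum>i=1..l. a i * x ^ (l - i))" using eq by (simp add: eq_neg_iff_add_eq_0)
      also have "\<dots> * x ^ (N - l) = - (\<Sum>i=1..l. a i * x ^ (N - i))"
        using False by (auto simp: sum_distrib_right mult.assoc power_add[symmetric] intro!: sum.cong)
      also have "\<dots> \<in> monomial_ideal (upset_power V U (N - l))"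
      proof (intro monomial_ideal_uminus monomial_ideal_sum)
        fix i assume i: "i \<in> {1..l}"
        then show "a i * x ^ (N - i) \<in> monomial_ideal (upset_power V U (N - l))"
          using False by (intro monomial_ideal_mpow_mult[OF U a less.IH]) auto
      qed
      finally show ?thesis .
    qed
  qed
  then show ?thesis by (auto simp: almost_integral_def)
qed

lemma almost_integral_add:
  assumes U: "upset V U" and x: "almost_integral V U x" and y: "almost_integral V U y"
  shows "almost_integral V U (x + y)"
proof -
  obtain c d where x: "\<And>N. x ^ N \<in> monomial_ideal (upset_power V U (N - c))"
    and y: "\<And>N. y ^ N \<in> monomial_ideal (upset_power V U (N - d))"
    using x y by (auto simp: almost_integral_def)
  have "(x + y) ^ N \<in> monomial_ideal (upset_power V U (N - (c + d)))" for N
    unfolding binomial_ring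
  proof (rule monomial_ideal_sum)
    fix k assume k: "k \<in> {..N}"
    have "of_nat (N choose k) \<in> monomial_ideal (upset_power V U 0)"
      by (simp add: single_of_nat[symmetric] monomial_ideal_singleI del: single_of_nat)
    then have "of_nat (N choose k) * x ^ k \<in> monomial_ideal (upset_power V U (k - c))"
      by (rule monomial_ideal_mpow_mult[OF U _ x]) simp
    then show "of_nat (N choose k) * x ^ k * y ^ (N - k) \<in> monomial_ideal (upset_power V U (N - (c + d)))"
      by (rule monomial_ideal_mpow_mult[OF U _ y]) (use k in auto)
  qed
  then show ?thesis by (auto simp: almost_integral_def)
qed

lemma single_power: "Poly_Mapping.single m (c::'k::field) ^ N = Poly_Mapping.single (scale N m) (c ^ N)"
  by (induction N) (simp_all add: mult_single scale_Suc add.commute)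

text \<open>A vertex of the Newton polytope: its multiples cannot arise in a power of \<open>f\<close> in two ways, so they
are not cancelled. A vertex is found as an exponent \<open>m0\<close> of maximal Euclidean norm. On the exponents
of \<open>f\<close> the inner product with \<open>m0\<close> then takes its maximum only at \<open>m0\<close>, which replaces the choice of a
monomial order.\<close>

lemma extreme_monomial:
  fixes f :: "('v, 'k::field) mpoly"
  assumes "f \<noteq> 0"
  obtains m where "m \<in> Poly_Mapping.keys f" "\<And>N. scale N m \<in> Poly_Mapping.keys (f ^ N)"
proof -
  let ?K = "Poly_Mapping.keys f"
  define T where "T = (\<Union>m\<in>?K. Poly_Mapping.keys m)"
  have T: "finite T" by (simp add: T_def)
  define q where "q = (\<lambda>m :: 'v \<Rightarrow>\<^sub>0 nat. \<Sum>t\<in>T. (Poly_Mapping.lookup m t)\<^sup>2)"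
  have "?K \<noteq> {}" using assms by (metis poly_sum_single sum.empty)
  then have "Max (q ` ?K) \<in> q ` ?K" by (intro Max_in) auto
  then obtain m0 where m0: "m0 \<in> ?K" "q m0 = Max (q ` ?K)" by force
  then have max: "q m \<le> q m0" if "m \<in> ?K" for m using that by simp
  note m0 = m0(1)
  define \<omega> where "\<omega> = (\<lambda>m :: 'v \<Rightarrow>\<^sub>0 nat. \<Sum>t\<in>T. Poly_Mapping.lookup m t * Poly_Mapping.lookup m0 t)"
  have \<omega>_add: "\<omega> (m + n) = \<omega> m + \<omega> n" for m n
    by (simp add: \<omega>_def lookup_add distrib_right sum.distrib)
  have \<omega>_0: "\<omega> 0 = 0" by (simp add: \<omega>_def)
  have \<omega>_scale: "\<omega> (scale N m) = N * \<omega> m" for N m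
    by (simp add: \<omega>_def sum_distrib_left mult.assoc)
  have less: "\<omega> m < \<omega> m0" if m: "m \<in> ?K" "m \<noteq> m0" for m
  proof -
    obtain t where t: "Poly_Mapping.lookup m t \<noteq> Poly_Mapping.lookup m0 t"
      using m(2) by (metis poly_mapping_eqI)
    then have "t \<in> Poly_Mapping.keys m \<or> t \<in> Poly_Mapping.keys m0" by (auto simp: in_keys_iff)
    then have "t \<in> T" using m m0 by (auto simp: T_def)
    \<comment> \<open>Summed over the coordinates, this gives \<open>2 (m \<bullet> m0) < m \<bullet> m + m0 \<bullet> m0\<close>, which is at most \<open>2 (m0 \<bullet> m0)\<close>.\<close>
    have sq: "2 * (a * b) < a\<^sup>2 + b\<^sup>2" if "a \<noteq> b" for a b :: nat
    proof -
      have "0 < (int a - int b)\<^sup>2" using that by simp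
      then have "int (2 * (a * b)) < int (a\<^sup>2 + b\<^sup>2)" by (simp add: power2_diff algebra_simps)
      then show ?thesis by (simp only: of_nat_less_iff)
    qed
    have "(\<Sum>t\<in>T. 2 * (Poly_Mapping.lookup m t * Poly_Mapping.lookup m0 t))
      < (\<Sum>t\<in>T. (Poly_Mapping.lookup m t)\<^sup>2 + (Poly_Mapping.lookup m0 t)\<^sup>2)"
    proof (rule sum_strict_mono_ex1[OF T])
      show "\<forall>t\<in>T. 2 * (Poly_Mapping.lookup m t * Poly_Mapping.lookup m0 t)
          \<le> (Poly_Mapping.lookup m t)\<^sup>2 + (Poly_Mapping.lookup m0 t)\<^sup>2"
        using sq by (metis less_imp_le mult_2 order_refl power2_eq_square)
    qed (use \<open>t \<in> T\<close> t sq in blast)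
    then have "2 * \<omega> m < q m + q m0"
      by (simp add: \<omega>_def q_def sum.distrib sum_distrib_left)
    moreover have "\<omega> m0 = q m0" by (simp add: \<omega>_def q_def power2_eq_square)
    ultimately show ?thesis using max[OF m(1)] by simp
  qed
  define c where "c = Poly_Mapping.lookup f m0"
  have c: "c \<noteq> 0" using m0 by (simp add: c_def in_keys_iff)
  define g where "g = f - Poly_Mapping.single m0 c"
  have f: "f = Poly_Mapping.single m0 c + g" by (simp add: g_def)
  have g: "\<omega> m < \<omega> m0" if "m \<in> Poly_Mapping.keys g" for m
    using that by (intro less) (auto simp: g_def c_def in_keys_iff lookup_minus lookup_single when_def split: if_splits)
  \<comment> \<open>The leading term of \<open>f ^ N\<close> with respect to \<open>\<omega>\<close>: all other terms have smaller weight.\<close>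
  have "\<exists>r. f ^ N = Poly_Mapping.single (scale N m0) (c ^ N) + r
      \<and> (\<forall>m\<in>Poly_Mapping.keys r. \<omega> m < N * \<omega> m0)" for N
  proof (induction N)
    case (Suc N)
    then obtain r where r: "f ^ N = Poly_Mapping.single (scale N m0) (c ^ N) + r"
      "\<And>m. m \<in> Poly_Mapping.keys r \<Longrightarrow> \<omega> m < N * \<omega> m0" by blast
    define s where "s = Poly_Mapping.single m0 c * r + g * f ^ N"
    have fN: "\<omega> m \<le> N * \<omega> m0" if "m \<in> Poly_Mapping.keys (f ^ N)" for m
      using that Poly_Mapping.keys_add[of "Poly_Mapping.single (scale N m0) (c ^ N)" r] r(2)[of m]
      by (auto simp: r(1) \<omega>_scale \<omega>_0 split: if_splits)
    have "f ^ Suc N = Poly_Mapping.single m0 c * f ^ N + g * f ^ N"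
      by (simp add: f distrib_right)
    also have "Poly_Mapping.single m0 c * f ^ N
        = Poly_Mapping.single (scale (Suc N) m0) (c ^ Suc N) + Poly_Mapping.single m0 c * r"
      by (simp add: r(1) distrib_left mult_single scale_Suc add.commute)
    finally have "f ^ Suc N = Poly_Mapping.single (scale (Suc N) m0) (c ^ Suc N) + s"
      by (simp add: s_def add.assoc)
    moreover have "\<omega> m < Suc N * \<omega> m0" if "m \<in> Poly_Mapping.keys s" for m
    proof -
      consider "m \<in> Poly_Mapping.keys (Poly_Mapping.single m0 c * r)" | "m \<in> Poly_Mapping.keys (g * f ^ N)"
        using \<open>m \<in> Poly_Mapping.keys s\<close> Poly_Mapping.keys_add by (fastforce simp: s_def)
      then show ?thesis
      proof cases
        case 1
        then obtain n where "m = m0 + n" "n \<in> Poly_Mapping.keys r"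
          using Poly_Mapping.keys_mult[of "Poly_Mapping.single m0 c" r] by (auto split: if_splits)
        then show ?thesis using r(2) by (simp add: \<omega>_add)
      next
        case 2
        then obtain n k where "m = n + k" "n \<in> Poly_Mapping.keys g" "k \<in> Poly_Mapping.keys (f ^ N)"
          using Poly_Mapping.keys_mult[of g "f ^ N"] by blast
        then show ?thesis using g[of n] fN[of k] by (simp add: \<omega>_add)
      qed
    qed
    ultimately show ?case by blast
  qed (auto intro!: exI[of _ 0])
  note * = this
  have "scale N m0 \<in> Poly_Mapping.keys (f ^ N)" for N
  proof -
    obtain r where r: "f ^ N = Poly_Mapping.single (scale N m0) (c ^ N) + r"
      "\<forall>m\<in>Poly_Mapping.keys r. \<omega> m < N * \<omega> m0" using * by blast
    then have "scale N m0 \<notin> Poly_Mapping.keys r" by (auto simp: \<omega>_scale)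
    then show ?thesis using c by (simp add: r(1) in_keys_iff lookup_add)
  qed
  then show ?thesis using m0 that by blast
qed

text \<open>An extreme monomial of an almost integral polynomial is almost integral, hence so is the
polynomial without this term. Removing terms one by one reaches every monomial.\<close>

lemma almost_integral_monomials:
  fixes f :: "('v, 'k::field) mpoly"
  assumes U: "upset V U" and f: "almost_integral V U f" and m: "m \<in> Poly_Mapping.keys f"
  shows "\<exists>c. \<forall>N. scale N m \<in> upset_power V U (N - c)"
  using f m
proof (induction "card (Poly_Mapping.keys f)" arbitrary: f rule: less_induct)
  case less
  have "f \<noteq> 0" using less.prems by auto
  then obtain m0 where m0: "m0 \<in> Poly_Mapping.keys f" "\<And>N. scale N m0 \<in> Poly_Mapping.keys (f ^ N)"
    using extreme_monomial by blast
  obtain c where c: "\<And>N. f ^ N \<in> monomial_ideal (upset_power V U (N - c))"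
    using less.prems(1) by (auto simp: almost_integral_def)
  have m0c: "scale N m0 \<in> upset_power V U (N - c)" for N
    using c[of N] m0(2)[of N] by (auto simp: monomial_ideal_def)
  show ?case
  proof (cases "m = m0")
    case True
    then show ?thesis using m0c by blast
  next
    case False
    define g where "g = f + Poly_Mapping.single m0 (- Poly_Mapping.lookup f m0)"
    have keys: "Poly_Mapping.keys g = Poly_Mapping.keys f - {m0}"
      by (auto simp: g_def in_keys_iff lookup_add lookup_single when_def split: if_splits)
    have "almost_integral V U (Poly_Mapping.single m0 (- Poly_Mapping.lookup f m0))"
      using m0c by (auto simp: almost_integral_def single_power intro!: monomial_ideal_singleI)
    then have "almost_integral V U g" unfolding g_def by (rule almost_integral_add[OF U less.prems(1)])
    moreover have "card (Poly_Mapping.keys g) < card (Poly_Mapping.keys f)"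
      unfolding keys using m0(1) by (intro psubset_card_mono) auto
    moreover have "m \<in> Poly_Mapping.keys g" using less.prems False by (simp add: keys)
    ultimately show ?thesis using less.hyps by blast
  qed
qed

section \<open>The determinant trick\<close>

text \<open>Cramer's rule: the adjugate of \<open>f - A\<close> is applied to the relation \<open>(f - A) v = 0\<close>.\<close>

lemma char_poly_kills:
  fixes A :: "'a::comm_ring_1 mat"
  assumes A: "A \<in> carrier_mat n n"
    and eig: "\<And>i. i < n \<Longrightarrow> f * v i = (\<Sum>j<n. A $$ (i, j) * v j)"
    and i: "i < n"
  shows "poly (char_poly A) f * v i = 0"
proof -
  define B where "B = mat n n (\<lambda>(i, j). (if i = j then f else 0) - A $$ (i, j))"
  have B: "B \<in> carrier_mat n n" by (simp add: B_def)
  have det: "poly (char_poly A) f = det B"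
    unfolding char_poly_def
    by (rule poly_det_cong[of _ n]) (use A in \<open>auto simp: B_def char_poly_matrix_def\<close>)
  have "B *\<^sub>v vec n v = 0\<^sub>v n"
  proof (rule eq_vecI)
    fix i assume i: "i < dim_vec (0\<^sub>v n :: 'a vec)"
    then have "(B *\<^sub>v vec n v) $ i = (\<Sum>j<n. ((if i = j then f else 0) - A $$ (i, j)) * v j)"
      by (simp add: B_def scalar_prod_def atLeast0LessThan)
    also have "\<dots> = (\<Sum>j<n. if i = j then f * v j else 0) - (\<Sum>j<n. A $$ (i, j) * v j)"
      unfolding sum_subtractf[symmetric] by (rule sum.cong) (auto simp: algebra_simps)
    also have "\<dots> = 0" using i eig by simp
    finally show "(B *\<^sub>v vec n v) $ i = 0\<^sub>v n $ i" using i by simp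
  qed (simp add: B_def)
  then have "(adj_mat B * B) *\<^sub>v vec n v = adj_mat B *\<^sub>v 0\<^sub>v n"
    using assoc_mult_mat_vec[OF adj_mat(1)[OF B] B, of "vec n v"] by simp
  then have "(det B \<cdot>\<^sub>m 1\<^sub>m n) *\<^sub>v vec n v = 0\<^sub>v n"
    using adj_mat[OF B] by auto
  then have "((det B \<cdot>\<^sub>m 1\<^sub>m n) *\<^sub>v vec n v) $ i = 0" using i by simp
  also have "((det B \<cdot>\<^sub>m 1\<^sub>m n) *\<^sub>v vec n v) $ i = (\<Sum>j=0..<n. det B * (if j = i then 1 else 0) * v j)"
    using i by (simp add: scalar_prod_def)
  also have "\<dots> = (\<Sum>j=0..<n. if j = i then det B * v j else 0)"
    by (rule sum.cong) auto
  also have "\<dots> = det B * v i" using i by simp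
  finally show ?thesis by (simp add: det)
qed

text \<open>The condition on the coefficients of an equation of integral dependence of degree \<open>n\<close>. For
\<open>k > n\<close> the truncated difference makes it require only that the coefficient lies in the ring.\<close>

definition graded_poly :: "'v set \<Rightarrow> ('v \<Rightarrow>\<^sub>0 nat) set \<Rightarrow> nat \<Rightarrow> ('v, 'k::field) mpoly poly \<Rightarrow> bool" where
  "graded_poly V U n p \<longleftrightarrow> (\<forall>k. poly.coeff p k \<in> monomial_ideal (upset_power V U (n - k)))"

lemma graded_poly_mult:
  assumes U: "upset V U" and p: "graded_poly V U m p" and q: "graded_poly V U n q"
  shows "graded_poly V U (m + n) (p * q)"
  unfolding graded_poly_def coeff_mult
proof (intro allI monomial_ideal_sum)
  fix k i :: nat assume "i \<in> {..k}"
  moreover have "poly.coeff p i \<in> monomial_ideal (upset_power V U (m - i))"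
    "poly.coeff q (k - i) \<in> monomial_ideal (upset_power V U (n - (k - i)))"
    using p q by (simp_all only: graded_poly_def)
  ultimately show "poly.coeff p i * poly.coeff q (k - i) \<in> monomial_ideal (upset_power V U (m + n - k))"
    by (intro monomial_ideal_mpow_mult[OF U, of _ "m - i" _ "n - (k - i)"]) auto
qed

lemma one_in_poly_ring: "1 \<in> monomial_ideal (exponents V)"
  by (simp add: monomial_ideal_def)

lemma graded_poly_0: "graded_poly V U 0 p \<longleftrightarrow> (\<forall>k. poly.coeff p k \<in> monomial_ideal (exponents V))"
  by (simp add: graded_poly_def)

text \<open>Every entry of the matrix \<open>T - A\<close> is homogeneous of degree 1 when \<open>T\<close> and the elements of the
ideal count as degree 1, so its determinant has degree \<open>n\<close>.\<close>

lemma graded_char_poly: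
  fixes A :: "('v, 'k::field) mpoly mat"
  assumes U: "upset V U" and A: "A \<in> carrier_mat n n"
    and coeffs: "\<And>i j. i < n \<Longrightarrow> j < n \<Longrightarrow> A $$ (i, j) \<in> monomial_ideal U"
  shows "graded_poly V U n (char_poly A)"
proof -
  let ?M = "char_poly_matrix A"
  have M: "?M \<in> carrier_mat n n" using A by simp
  have entry: "graded_poly V U 1 (?M $$ (i, j))" if "i < n" "j < n" for i j
  proof -
    have "- (A $$ (i, j)) \<in> monomial_ideal (upset_power V U (Suc 0))"
      using coeffs[OF that] by (simp only: upset_power_1[OF U] monomial_ideal_uminus)
    then show ?thesis
      using that A one_in_poly_ring[of V]
      by (auto simp: graded_poly_def char_poly_matrix_def coeff_pCons split: nat.split)
  qed
  have prod: "graded_poly V U (card I) (\<Prod>i\<in>I. g i)" if "finite I" "\<And>i. i \<in> I \<Longrightarrow> graded_poly V U 1 (g i)"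
    for I :: "nat set" and g :: "nat \<Rightarrow> ('v, 'k) mpoly poly"
    using that
  proof (induction I)
    case empty
    then show ?case using one_in_poly_ring[of V] by (auto simp: graded_poly_def)
  next
    case (insert a I)
    then show ?case using graded_poly_mult[OF U, of 1 "g a" "card I" "prod g I"] by simp
  qed
  have "graded_poly V U n (signof p * (\<Prod>i=0..<n. ?M $$ (i, p i)))" if p: "p permutes {0..<n}" for p
  proof -
    have "graded_poly V U 0 (signof p :: ('v, 'k) mpoly poly)"
      using one_in_poly_ring[of V] monomial_ideal_uminus[OF one_in_poly_ring[of V]]
      by (cases p rule: sign_cases) (auto simp: graded_poly_0)
    moreover have "graded_poly V U n (\<Prod>i=0..<n. ?M $$ (i, p i))"
      using prod[of "{0..<n}"] entry permutes_in_image[OF p] by auto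
    ultimately show ?thesis using graded_poly_mult[OF U, of 0] by fastforce
  qed
  then show ?thesis
    unfolding char_poly_def det_def'[OF M] graded_poly_def coeff_sum
    by (auto intro!: monomial_ideal_sum)
qed

text \<open>Monomials are not zero divisors, since multiplication by one only shifts exponents.\<close>

lemma mult_monomial_eq_0:
  fixes p :: "('v, 'k::field) mpoly"
  assumes "p * Poly_Mapping.single b 1 = 0"
  shows "p = 0"
proof (rule poly_mapping_eqI)
  fix k
  let ?K = "Poly_Mapping.keys p"
  have "p * Poly_Mapping.single b 1
      = (\<Sum>m\<in>?K. Poly_Mapping.single m (Poly_Mapping.lookup p m)) * Poly_Mapping.single b 1"
    by (simp only: poly_sum_single[symmetric])
  also have "\<dots> = (\<Sum>m\<in>?K. Poly_Mapping.single (m + b) (Poly_Mapping.lookup p m))"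
    by (simp add: sum_distrib_right mult_single)
  finally have "0 = Poly_Mapping.lookup (\<Sum>m\<in>?K. Poly_Mapping.single (m + b) (Poly_Mapping.lookup p m)) (k + b)"
    using assms by simp
  then have "0 = (\<Sum>m\<in>?K. Poly_Mapping.lookup (Poly_Mapping.single (m + b) (Poly_Mapping.lookup p m)) (k + b))"
    by (simp only: lookup_sum)
  also have "\<dots> = (\<Sum>m\<in>?K. if m = k then Poly_Mapping.lookup p m else 0)"
    by (rule sum.cong) (auto simp: lookup_single when_def)
  also have "\<dots> = Poly_Mapping.lookup p k" by (simp add: in_keys_iff)
  finally show "Poly_Mapping.lookup p k = Poly_Mapping.lookup 0 k" by simp
qed

section \<open>The integral closure of a monomial ideal\<close>

text \<open>Sums of integral monomials are integral by the determinant trick. The monomials of \<open>M\<close> from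
\<open>newton_closure_exchange\<close> satisfy a linear system \<open>f v = A v\<close> with coefficients in the ideal, so the
characteristic polynomial of \<open>A\<close> vanishes at \<open>f\<close>; it is monic, and its coefficients lie in the right
powers of the ideal.\<close>

lemma newton_closure_imp_integral:
  fixes f :: "('v, 'k::field) mpoly"
  assumes V: "finite V" and U: "upset V U" and f: "f \<in> monomial_ideal (newton_closure V U)"
  shows "f \<in> integral_closure (poly_ring V) (monomial_ideal U)"
proof (cases "f = 0")
  case True
  then show ?thesis unfolding integral_closure_monomial_ideal_iff[OF U]
    by (auto intro!: exI[of _ 1] exI[of _ "\<lambda>_. 0"])
next
  case False
  let ?F = "Poly_Mapping.keys f"
  have F: "?F \<subseteq> newton_closure V U" using f by (simp add: monomial_ideal_def)
  have "?F \<noteq> {}" using False by (metis poly_sum_single sum.empty)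
  then obtain M where M: "finite M" "M \<noteq> {}" "?F + M \<subseteq> U + M"
    using newton_closure_exchange[OF V U finite_keys F] by blast
  have "\<exists>u b'. u \<in> U \<and> b' \<in> M \<and> m + b = u + b'" if "m \<in> ?F" "b \<in> M" for m b
  proof -
    have "m + b \<in> U + M" using M(3) that by blast
    then show ?thesis by (auto simp: set_plus_def)
  qed
  then obtain u b' where ub: "\<And>m b. m \<in> ?F \<Longrightarrow> b \<in> M \<Longrightarrow> u m b \<in> U \<and> b' m b \<in> M \<and> m + b = u m b + b' m b"
    by metis
  define D where "D = card M"
  obtain h where h: "bij_betw h {..<D} M"
    using ex_bij_betw_nat_finite[OF M(1)] by (auto simp: D_def atLeast0LessThan)
  have hM: "h i \<in> M" if "i < D" for i using bij_betwE[OF h] that by auto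
  have D: "D \<ge> 1" using M by (simp add: D_def Suc_le_eq card_gt_0_iff)
  \<comment> \<open>The term of \<open>f\<close> at \<open>m\<close> sends the basis monomial \<open>h i\<close> to the multiple of \<open>b' m (h i)\<close> by \<open>u m (h i)\<close>.\<close>
  define A where "A = mat D D (\<lambda>(i, j). \<Sum>m\<in>{m\<in>?F. b' m (h i) = h j}. 
    Poly_Mapping.single (u m (h i)) (Poly_Mapping.lookup f m))"
  have A: "A \<in> carrier_mat D D" by (simp add: A_def)
  let ?v = "\<lambda>j. Poly_Mapping.single (h j) (1 :: 'k)"
  have eig: "f * ?v i = (\<Sum>j<D. A $$ (i, j) * ?v j)" if i: "i < D" for i
  proof -
    let ?t = "\<lambda>m. Poly_Mapping.single (m + h i) (Poly_Mapping.lookup f m)"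
    have "(\<Sum>j<D. A $$ (i, j) * ?v j) = (\<Sum>j<D. \<Sum>m\<in>{m\<in>?F. b' m (h i) = h j}. ?t m)"
    proof (rule sum.cong[OF refl])
      fix j assume "j \<in> {..<D}"
      then have "A $$ (i, j) * ?v j = (\<Sum>m\<in>{m\<in>?F. b' m (h i) = h j}. 
         Poly_Mapping.single (u m (h i) + h j) (Poly_Mapping.lookup f m))"
        using i by (simp add: A_def sum_distrib_right mult_single)
      also have "\<dots> = (\<Sum>m\<in>{m\<in>?F. b' m (h i) = h j}. ?t m)"
        using ub[OF _ hM[OF i]] by (intro sum.cong) auto
      finally show "A $$ (i, j) * ?v j = (\<Sum>m\<in>{m\<in>?F. b' m (h i) = h j}. ?t m)" .
    qed
    also have "\<dots> = (\<Sum>b\<in>M. \<Sum>m\<in>{m\<in>?F. b' m (h i) = b}. ?t m)"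
      by (rule sum.reindex_bij_betw[OF h])
    also have "\<dots> = (\<Sum>m\<in>?F. ?t m)"
      using ub[OF _ hM[OF i]] by (intro sum.group) (auto simp: M)
    also have "\<dots> = (\<Sum>m\<in>?F. Poly_Mapping.single m (Poly_Mapping.lookup f m)) * ?v i"
      by (simp add: sum_distrib_right mult_single)
    also have "\<dots> = f * ?v i" by (simp only: poly_sum_single[symmetric])
    finally show ?thesis by simp
  qed
  define p where "p = char_poly A"
  have "poly p f * ?v 0 = 0" 
    unfolding p_def using char_poly_kills[OF A eig, of 0] D by simp
  then have p0: "poly p f = 0" by (rule mult_monomial_eq_0)
  have p: "degree p = D" "poly.coeff p D = 1"
    using degree_monic_char_poly[OF A] by (auto simp: p_def)
  have gr: "graded_poly V U D p"
    unfolding p_def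
    by (rule graded_char_poly[OF U A]) (use ub hM in \<open>auto simp: A_def intro!: monomial_ideal_sum monomial_ideal_singleI\<close>)
  define a where "a = (\<lambda>i. poly.coeff p (D - i))"
  have "a i \<in> monomial_ideal (upset_power V U i)" if "i \<in> {1..D}" for i
    using gr[unfolded graded_poly_def, rule_format, of "D - i"] that by (simp add: a_def)
  moreover have "f ^ D + (\<Sum>i=1..D. a i * f ^ (D - i)) = 0"
  proof -
    have "(\<Sum>i=1..D. a i * f ^ (D - i)) = (\<Sum>k<D. poly.coeff p k * f ^ k)"
      by (rule sum.reindex_bij_witness[of _ "\<lambda>k. D - k" "\<lambda>k. D - k"]) (auto simp: a_def)
    moreover have "poly p f = f ^ D + (\<Sum>k<D. poly.coeff p k * f ^ k)"
      by (simp add: poly_altdef p lessThan_Suc_atMost[symmetric])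
    ultimately show ?thesis using p0 by simp
  qed
  moreover have "f \<in> monomial_ideal (exponents V)"
    using monomial_ideal_upset[OF upset_newton_closure[OF U] f] .
  ultimately show ?thesis unfolding integral_closure_monomial_ideal_iff[OF U] using D by blast
qed

text \<open>An element of the integral closure is almost integral, so each of its monomials is, and these
belong to the Newton closure.\<close>

theorem integral_closure_monomial_ideal:
  assumes V: "finite V" and U: "upset V U"
  shows "integral_closure (poly_ring V) (monomial_ideal U) = (monomial_ideal (newton_closure V U) :: ('v, 'k::field) mpoly set)"
proof
  show "integral_closure (poly_ring V) (monomial_ideal U) \<subseteq> (monomial_ideal (newton_closure V U) :: ('v, 'k) mpoly set)"
  proof
    fix f :: "('v, 'k) mpoly" assume f: "f \<in> integral_closure (poly_ring V) (monomial_ideal U)"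
    have "m \<in> newton_closure V U" if m: "m \<in> Poly_Mapping.keys f" for m
    proof -
      obtain c where "\<And>N. scale N m \<in> upset_power V U (N - c)"
        using almost_integral_monomials[OF U integral_imp_almost_integral[OF U f] m] by blast
      moreover have "m \<in> exponents V"
        using f m unfolding integral_closure_monomial_ideal_iff[OF U] by (auto simp: monomial_ideal_def)
      ultimately show ?thesis using almost_power_imp_newton_closure[OF V U] by blast
    qed
    then show "f \<in> monomial_ideal (newton_closure V U)" by (auto simp: monomial_ideal_def)
  qed
qed (use newton_closure_imp_integral[OF V U] in blast)

section \<open>Integral closure of a product over blocks\<close>

lemma normal_monomial_ideal_iff:
  assumes V: "finite V" and U: "upset V U"
  shows "normal_ideal (poly_ring V) (monomial_ideal U :: ('v, 'k::field) mpoly set)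
    \<longleftrightarrow> (\<forall>n\<ge>1. upset_power V U n = newton_closure V (upset_power V U n))"
  by (simp add: normal_ideal_def ideal_pow_monomial_ideal integral_closure_monomial_ideal[OF V upset_upset_power[OF U]]
      monomial_ideal_eq_iff)

text \<open>Both sides are monomial ideals, and on exponents products, powers and Newton closures are all
computed block by block.\<close>

theorem integral_closure_pow_finprod:
  fixes V :: "'v set"
  assumes V: "finite V" and fin: "finite I"
    and dis: "\<And>i j. i \<in> I \<Longrightarrow> j \<in> I \<Longrightarrow> i \<noteq> j \<Longrightarrow> W i \<inter> W j = {}"
    and up: "\<And>i. i \<in> I \<Longrightarrow> upset V (U i)"
    and supp: "\<And>i. i \<in> I \<Longrightarrow> restriction_closed (W i) (U i)"
  defines "S \<equiv> (poly_ring V :: ('v, 'k::field) mpoly ring)"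
  shows "integral_closure S (ideal_pow S (\<Otimes>\<^bsub>ideals_set S\<^esub>i\<in>I. monomial_ideal (U i)) n)
    = (\<Otimes>\<^bsub>ideals_set S\<^esub>i\<in>I. integral_closure S (ideal_pow S (monomial_ideal (U i)) n))"
proof -
  have P: "(\<Otimes>\<^bsub>ideals_set S\<^esub>i\<in>I. monomial_ideal (U i)) = monomial_ideal (blockwise V I W U)"
    unfolding S_def by (rule finprod_monomial_ideal[OF fin dis up supp])
  have "integral_closure S (ideal_pow S (monomial_ideal (blockwise V I W U)) n)
      = monomial_ideal (newton_closure V (upset_power V (blockwise V I W U) n))"
    unfolding S_def ideal_pow_monomial_ideal
    by (intro integral_closure_monomial_ideal[OF V] upset_upset_power upset_blockwise up)
  also have "upset_power V (blockwise V I W U) n = blockwise V I W (\<lambda>i. upset_power V (U i) n)"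
    by (rule upset_power_blockwise[OF fin dis up supp])
  also have "newton_closure V \<dots> = blockwise V I W (\<lambda>i. newton_closure V (upset_power V (U i) n))"
    by (rule newton_closure_blockwise[OF fin dis upset_upset_power[OF up] restriction_closed_upset_power[OF supp]])
  also have "monomial_ideal \<dots> = (\<Otimes>\<^bsub>ideals_set S\<^esub>i\<in>I. monomial_ideal (newton_closure V (upset_power V (U i) n)))"
    unfolding S_def
    by (rule finprod_monomial_ideal[symmetric, OF fin dis upset_newton_closure[OF upset_upset_power[OF up]]
          restriction_closed_newton_closure[OF restriction_closed_upset_power[OF supp]]])
  also have "\<dots> = (\<Otimes>\<^bsub>ideals_set S\<^esub>i\<in>I. integral_closure S (ideal_pow S (monomial_ideal (U i)) n))"
  proof -
    interpret cring "poly_ring V :: ('v, 'k) mpoly ring" by (rule cring_poly_ring)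
    interpret M: comm_monoid "ideals_set S" unfolding S_def by (rule ideals_set_is_comm_monoid)
    have eq: "monomial_ideal (newton_closure V (upset_power V (U i) n)) = integral_closure S (ideal_pow S (monomial_ideal (U i)) n)"
      if "i \<in> I" for i
      unfolding S_def ideal_pow_monomial_ideal
      by (rule integral_closure_monomial_ideal[symmetric, OF V upset_upset_power[OF up[OF that]]])
    have "monomial_ideal (newton_closure V (upset_power V (U i) n)) \<in> carrier (ideals_set S)" if "i \<in> I" for i
      using ideal_monomial_ideal[OF upset_newton_closure[OF upset_upset_power[OF up[OF that]]]]
      by (simp add: ideals_set_def S_def)
    then show ?thesis by (intro M.finprod_cong') (auto simp: eq)
  qed
  finally show ?thesis unfolding P .
qed

text \<open>By the block by block description, normality of the product compares, for each power, two products
over the blocks. As the factors are nonzero, equality of these products means equality of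
all factors.\<close>

theorem normal_finprod_iff:
  fixes V :: "'v set"
  assumes V: "finite V" and fin: "finite I"
    and dis: "\<And>i j. i \<in> I \<Longrightarrow> j \<in> I \<Longrightarrow> i \<noteq> j \<Longrightarrow> W i \<inter> W j = {}"
    and up: "\<And>i. i \<in> I \<Longrightarrow> upset V (U i)"
    and supp: "\<And>i. i \<in> I \<Longrightarrow> restriction_closed (W i) (U i)"
    and ne: "\<And>i. i \<in> I \<Longrightarrow> U i \<noteq> {}"
  defines "S \<equiv> (poly_ring V :: ('v, 'k::field) mpoly ring)"
  shows "normal_ideal S (\<Otimes>\<^bsub>ideals_set S\<^esub>i\<in>I. monomial_ideal (U i)) \<longleftrightarrow> (\<forall>i\<in>I. normal_ideal S (monomial_ideal (U i)))"
proof -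
  let ?P = "\<lambda>n i. upset_power V (U i) n"
  let ?C = "\<lambda>n i. newton_closure V (upset_power V (U i) n)"
  have upP: "upset V (?P n i)" and upC: "upset V (?C n i)" if "i \<in> I" for n i
    using up[OF that] by (simp_all add: upset_upset_power upset_newton_closure)
  have suP: "restriction_closed (W i) (?P n i)" and suC: "restriction_closed (W i) (?C n i)" if "i \<in> I" for n i
    using supp[OF that] by (simp_all add: restriction_closed_upset_power restriction_closed_newton_closure)
  have neP: "?P n i \<noteq> {}" and neC: "?C n i \<noteq> {}" if i: "i \<in> I" for n i
  proof -
    from ne[OF i] obtain u where "u \<in> U i" by blast
    then show "?P n i \<noteq> {}" using scale_in_upset_power by blast
    then show "?C n i \<noteq> {}" using subset_newton_closure[OF upP[OF i]] by blast
  qed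
  have power_eq: "upset_power V (blockwise V I W U) n = blockwise V I W (?P n)" for n
    by (rule upset_power_blockwise[OF fin dis up supp])
  have closure_eq: "newton_closure V (blockwise V I W (?P n)) = blockwise V I W (?C n)" for n
    by (rule newton_closure_blockwise[OF fin dis upP suP])
  have blockwise_eq: "blockwise V I W (?P n) = blockwise V I W (?C n) \<longleftrightarrow> (\<forall>i\<in>I. ?P n i = ?C n i)" for n
  proof
    assume eq: "blockwise V I W (?P n) = blockwise V I W (?C n)"
    show "\<forall>i\<in>I. ?P n i = ?C n i"
    proof
      fix i assume i: "i \<in> I"
      show "?P n i = ?C n i"
      proof
        show "?P n i \<subseteq> ?C n i"
          by (rule subset_newton_closure[OF upP[OF i]])
        show "?C n i \<subseteq> ?P n i"
          by (rule blockwise_subset_imp[OF fin dis upC upP suC neC _ i]) (simp_all add: eq)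
      qed
    qed
  qed (auto simp: blockwise_def)
  have "(\<Otimes>\<^bsub>ideals_set S\<^esub>i\<in>I. monomial_ideal (U i)) = monomial_ideal (blockwise V I W U)"
    unfolding S_def by (rule finprod_monomial_ideal[OF fin dis up supp])
  then have "normal_ideal S (\<Otimes>\<^bsub>ideals_set S\<^esub>i\<in>I. monomial_ideal (U i)) \<longleftrightarrow>
     (\<forall>n\<ge>1. upset_power V (blockwise V I W U) n = newton_closure V (upset_power V (blockwise V I W U) n))"
    unfolding S_def by (simp only: normal_monomial_ideal_iff[OF V upset_blockwise[OF up]])
  also have "\<dots> \<longleftrightarrow> (\<forall>n\<ge>1. blockwise V I W (?P n) = blockwise V I W (?C n))"
    by (simp only: power_eq closure_eq)
  also have "\<dots> \<longleftrightarrow> (\<forall>i\<in>I. normal_ideal S (monomial_ideal (U i)))"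
    unfolding S_def blockwise_eq by (auto simp: normal_monomial_ideal_iff[OF V up])
  finally show ?thesis .
qed

section \<open>Vertex covers and connected components\<close>

lemma strongly_connected_imp_connected: "strongly_connected H \<Longrightarrow> Digraph_Component.connected H"
  unfolding connected_conv strongly_connected_def reachable_def
  by (auto intro: rtrancl_on_mono simp: symcl_def)

lemma arc_mono_connected: "arc_mono Digraph_Component.connected"
  unfolding arc_mono_def
  by (metis spanning_def subgraphE wf_digraph.connected_spanning_imp_connected)

lemma (in sym_digraph) induced_connected_imp_strongly_connected:
  assumes "induced_subgraph H G" "Digraph_Component.connected H"
  shows "strongly_connected H"
proof -
  interpret H: wf_digraph H using assms(1) by auto
  show ?thesis
    using H.symmetric_connected_imp_strongly_connected induced_graph_imp_symmetric[OF sym_arcs assms(1)] assms(2) by blast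
qed

text \<open>In a symmetric digraph an induced subgraph is
symmetric too, so connected and strongly connected mean the same for it; and maximal subgraphs are
induced, because adding arcs preserves connectedness.\<close>

lemma (in sym_digraph) connected_components_eq_sccs: "connected_components G = sccs"
  unfolding sccs_altdef2 connected_components_def
proof (intro Collect_cong iffI)
  fix H assume H: "max_subgraph Digraph_Component.connected H"
  then have "strongly_connected H"
    using induced_connected_imp_strongly_connected induced_subgraphI_arc_mono[OF H arc_mono_connected]
      max_subgraph_prop by blast
  then show "max_subgraph strongly_connected H"
    using max_subgraph_mp[OF H] strongly_connected_imp_connected by blast
next
  fix H assume H: "max_subgraph strongly_connected H"
  show "max_subgraph Digraph_Component.connected H"
  proof (rule max_subgraphI)
    show "Digraph_Component.connected H"
      using H by (blast intro: strongly_connected_imp_connected dest: max_subgraph_prop)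
    show "subgraph H G" using H by (rule subgraphI_max_subgraph)
    fix K assume K: "H \<noteq> K" "subgraph H K" "subgraph K G"
    show "\<not> Digraph_Component.connected K"
    proof
      assume c: "Digraph_Component.connected K"
      let ?K = "G \<restriction> verts K"
      have KK: "subgraph K ?K" using K(3) by (rule subgraph_induce_subgraphI2)
      have ind: "induced_subgraph ?K G" using K(3) by (intro induced_induce) auto
      have "Digraph_Component.connected ?K"
        using arc_mono_connected KK c unfolding arc_mono_def by (metis induce_subgraph_verts)
      then have "strongly_connected ?K" by (rule induced_connected_imp_strongly_connected[OF ind])
      moreover have "subgraph H ?K" using K(2) KK by (rule subgraph_trans)
      ultimately have "H = ?K" using H ind by (auto simp: max_subgraph_def)
      then have "H = K" using K(2) KK
        by (intro pre_digraph.equality) (auto simp: subgraph_def compatible_def)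
      then show False using K(1) by simp
    qed
  qed
qed

context graph
begin

lemma finite_connected_components: "finite (connected_components G)"
  using finite_sccs_verts by (simp add: connected_components_eq_sccs sccs_conv_sccs_verts)

lemma connected_components_disjoint:
  "H \<in> connected_components G \<Longrightarrow> K \<in> connected_components G \<Longrightarrow> H \<noteq> K \<Longrightarrow> verts H \<inter> verts K = {}"
  by (simp add: connected_components_eq_sccs scc_disj)

lemma component_subgraph: "H \<in> connected_components G \<Longrightarrow> subgraph H G"
  by (simp add: connected_components_def subgraphI_max_subgraph)

lemma Union_components:
  "(\<Union>H\<in>connected_components G. verts H) = verts G"
  "(\<Union>H\<in>connected_components G. arcs H) = arcs G"
  using arg_cong[OF graph_is_union_sccs, of verts] arg_cong[OF graph_is_union_sccs, of arcs]
  by (simp_all add: connected_components_eq_sccs Union_def)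

lemma vertex_cover_iff_components:
  "vertex_cover G C \<longleftrightarrow> C \<subseteq> verts G \<and> (\<forall>H\<in>connected_components G. vertex_cover H (C \<inter> verts H))"
proof -
  have ends: "tail H e = tail G e" "head H e = head G e" "tail G e \<in> verts H" "head G e \<in> verts H"
    if "H \<in> connected_components G" "e \<in> arcs H" for H e
  proof -
    have "subgraph H G" using that by (simp add: component_subgraph)
    then have eq: "tail H = tail G" "head H = head G" and "wf_digraph H" by (auto simp: subgraph_def compatible_def)
    then show "tail H e = tail G e" "head H e = head G e" "tail G e \<in> verts H" "head G e \<in> verts H"
      using that wf_digraph.wellformed[of H] by (metis eq)+
  qed
  have "(\<forall>e\<in>arcs G. tail G e \<in> C \<or> head G e \<in> C)
    \<longleftrightarrow> (\<forall>H\<in>connected_components G. \<forall>e\<in>arcs H. tail G e \<in> C \<or> head G e \<in> C)"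
    unfolding Union_components(2)[symmetric] by blast
  also have "\<dots> \<longleftrightarrow> (\<forall>H\<in>connected_components G. vertex_cover H (C \<inter> verts H))"
    unfolding vertex_cover_def by (intro ball_cong refl) (auto simp: ends)
  finally show ?thesis by (auto simp: vertex_cover_def)
qed

text \<open>No arc joins two components, so a cover of one component can be replaced by a smaller
one without disturbing the others.\<close>

lemma minimal_vertex_cover_iff_components:
  "minimal_vertex_cover G C \<longleftrightarrow>
    C \<subseteq> verts G \<and> (\<forall>H\<in>connected_components G. minimal_vertex_cover H (C \<inter> verts H))"
proof (intro iffI conjI ballI)
  assume C: "minimal_vertex_cover G C"
  then show sub: "C \<subseteq> verts G" by (simp add: minimal_vertex_cover_def vertex_cover_def)
  fix H assume H: "H \<in> connected_components G"
  have cov: "vertex_cover K (C \<inter> verts K)" if "K \<in> connected_components G" for K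
    using C that by (auto simp: minimal_vertex_cover_def vertex_cover_iff_components)
  have "\<not> vertex_cover H D" if D: "D \<subset> C \<inter> verts H" for D
  proof
    assume DH: "vertex_cover H D"
    let ?E = "(C - verts H) \<union> D"
    have "vertex_cover K (?E \<inter> verts K)" if K: "K \<in> connected_components G" for K
    proof (cases "K = H")
      case True
      have "?E \<inter> verts H = D" using D by blast
      with True DH show ?thesis by simp
    next
      case False
      have "?E \<inter> verts K = C \<inter> verts K"
        using connected_components_disjoint[OF K H False] D by blast
      then show ?thesis using cov[OF K] by simp
    qed
    then have "vertex_cover G ?E" using sub D by (auto simp: vertex_cover_iff_components)
    moreover have "?E \<subset> C" using D by blast
    ultimately show False using C by (simp add: minimal_vertex_cover_def)
  qed
  then show "minimal_vertex_cover H (C \<inter> verts H)" using cov[OF H] by (simp add: minimal_vertex_cover_def)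
next
  assume C: "C \<subseteq> verts G \<and> (\<forall>H\<in>connected_components G. minimal_vertex_cover H (C \<inter> verts H))"
  then have "vertex_cover G C" by (simp add: vertex_cover_iff_components minimal_vertex_cover_def)
  moreover have "\<not> vertex_cover G D" if D: "D \<subset> C" for D
  proof
    assume "vertex_cover G D"
    then have "\<not> D \<inter> verts H \<subset> C \<inter> verts H" if "H \<in> connected_components G" for H
      using C that unfolding vertex_cover_iff_components minimal_vertex_cover_def by blast
    then have "C \<inter> verts H \<subseteq> D" if "H \<in> connected_components G" for H
      using D that by blast
    then have "C \<subseteq> D" using C Union_components(1) by blast
    then show False using D by blast
  qed
  ultimately show "minimal_vertex_cover G C" by (simp add: minimal_vertex_cover_def)
qed

end

lemma (in fin_digraph) ex_minimal_vertex_cover: "\<exists>C. minimal_vertex_cover G C"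
proof -
  have "vertex_cover G (verts G)" by (simp add: vertex_cover_def)
  then obtain C where C: "vertex_cover G C" and min: "\<And>D. vertex_cover G D \<Longrightarrow> card C \<le> card D"
    using ex_has_least_nat[of "vertex_cover G" _ card] by blast
  have "finite C" using C finite_verts by (auto simp: vertex_cover_def intro: finite_subset)
  then have "\<not> vertex_cover G D" if "D \<subset> C" for D
    using min[of D] psubset_card_mono[OF _ that] by auto
  then show ?thesis using C by (auto simp: minimal_vertex_cover_def)
qed

section \<open>Cover ideals as monomial ideals\<close>

definition squarefree_exponent :: "'v set \<Rightarrow> ('v \<Rightarrow>\<^sub>0 nat)" where
  "squarefree_exponent C = (\<Sum>t\<in>C. Poly_Mapping.single t 1)"

lemma lookup_squarefree_exponent: "finite C \<Longrightarrow> Poly_Mapping.lookup (squarefree_exponent C) t = (if t \<in> C then 1 else 0)"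
  by (simp add: squarefree_exponent_def lookup_sum lookup_single when_def)

lemma prod_var: "(\<Prod>t\<in>C. var t) = (Poly_Mapping.single (squarefree_exponent C) 1 :: ('v, 'k::field) mpoly)"
  by (induction C rule: infinite_finite_induct) (simp_all add: squarefree_exponent_def var_def mult_single)

definition cover_upset :: "'v set \<Rightarrow> ('v, 'e) pre_digraph \<Rightarrow> ('v \<Rightarrow>\<^sub>0 nat) set" where
  "cover_upset V H = squarefree_exponent ` {C. minimal_vertex_cover H C} + exponents V"

lemma minimal_cover_finite:
  "finite V \<Longrightarrow> verts H \<subseteq> V \<Longrightarrow> minimal_vertex_cover H C \<Longrightarrow> finite C \<and> C \<subseteq> verts H"
  by (auto simp: minimal_vertex_cover_def vertex_cover_def intro: finite_subset)

lemma squarefree_exponent_in_exponents: "finite C \<Longrightarrow> C \<subseteq> V \<Longrightarrow> squarefree_exponent C \<in> exponents V"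
  by (auto simp: exponents_iff_lookup lookup_squarefree_exponent)

lemma
  assumes V: "finite V" "verts H \<subseteq> V"
  shows upset_cover_upset: "upset V (cover_upset V H)"
    and cover_ideal_eq: "cover_ideal (poly_ring V :: ('v, 'k::field) mpoly ring) H = monomial_ideal (cover_upset V H)"
    and restriction_closed_cover_upset: "restriction_closed (verts H) (cover_upset V H)"
proof -
  have sub: "squarefree_exponent ` {C. minimal_vertex_cover H C} \<subseteq> exponents V"
    using minimal_cover_finite[OF V] V(2) by (auto intro!: squarefree_exponent_in_exponents)
  then show "upset V (cover_upset V H)" unfolding cover_upset_def by (rule upset_generated)
  have "{\<Prod>t\<in>C. var t | C. minimal_vertex_cover H C}
    = (\<lambda>a. Poly_Mapping.single a 1 :: ('v, 'k) mpoly) ` squarefree_exponent ` {C. minimal_vertex_cover H C}"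
    by (auto simp: prod_var)
  then show "cover_ideal (poly_ring V :: ('v, 'k) mpoly ring) H = monomial_ideal (cover_upset V H)"
    unfolding cover_ideal_def cover_upset_def by (simp add: Idl_monomials[OF sub])
  have "restrict_exponent (verts H) (squarefree_exponent C) = squarefree_exponent C" if "minimal_vertex_cover H C" for C
    using minimal_cover_finite[OF V that] by (intro poly_mapping_eqI) (auto simp: lookup_squarefree_exponent)
  then show "restriction_closed (verts H) (cover_upset V H)"
    by (auto simp: restriction_closed_def cover_upset_def restrict_exponent_add exponents_restrict elim!: set_plus_elim intro!: set_plus_intro)
qed

text \<open>The combinatorial content of the factorization of the ideal of covers: minimal covers of \<open>G\<close> are
the same as independent choices of minimal covers of all components.\<close>

lemma (in graph) cover_upset_eq_blockwise:
  "cover_upset (verts G) G = blockwise (verts G) (connected_components G) verts (cover_upset (verts G))"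
proof (intro equalityI subsetI)
  let ?V = "verts G"
  fix m assume "m \<in> cover_upset ?V G"
  then obtain C x where m: "m = squarefree_exponent C + x" "minimal_vertex_cover G C" "x \<in> exponents ?V"
    by (auto simp: cover_upset_def elim!: set_plus_elim)
  have C: "finite C" "C \<subseteq> ?V" using minimal_cover_finite[OF finite_verts order_refl m(2)] by auto
  have "restrict_exponent (verts H) m \<in> cover_upset ?V H" if H: "H \<in> connected_components G" for H
  proof -
    have "restrict_exponent (verts H) m = squarefree_exponent (C \<inter> verts H) + restrict_exponent (verts H) x"
      using C by (intro poly_mapping_eqI) (auto simp: m lookup_add lookup_squarefree_exponent)
    moreover have "minimal_vertex_cover H (C \<inter> verts H)"
      using m(2) H by (simp add: minimal_vertex_cover_iff_components)
    ultimately show ?thesis using exponents_restrict[OF m(3)]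
      by (auto simp: cover_upset_def intro!: set_plus_intro)
  qed
  moreover have "m \<in> exponents ?V" using m squarefree_exponent_in_exponents[OF C] by (simp add: exponents_add)
  ultimately show "m \<in> blockwise ?V (connected_components G) verts (cover_upset ?V)" by (simp add: blockwise_def)
next
  let ?V = "verts G"
  have HV: "verts H \<subseteq> ?V" if "H \<in> connected_components G" for H
    using component_subgraph[OF that] by auto
  fix m assume "m \<in> blockwise ?V (connected_components G) verts (cover_upset ?V)"
  then have mV: "m \<in> exponents ?V" and "\<forall>H\<in>connected_components G. \<exists>C x. minimal_vertex_cover H C \<and> 
      restrict_exponent (verts H) m = squarefree_exponent C + x"
    by (fastforce simp: blockwise_def cover_upset_def set_plus_def)+
  then obtain C x where C: "\<And>H. H \<in> connected_components G \<Longrightarrow> minimal_vertex_cover H (C H)"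
    and m: "\<And>H. H \<in> connected_components G \<Longrightarrow> restrict_exponent (verts H) m = squarefree_exponent (C H) + x H"
    by metis
  have CH: "finite (C H)" "C H \<subseteq> verts H" if "H \<in> connected_components G" for H
    using minimal_cover_finite[OF finite_verts HV C] that by auto
  define D where "D = (\<Union>H\<in>connected_components G. C H)"
  have "D \<inter> verts H = C H" if H: "H \<in> connected_components G" for H
    using CH(2) connected_components_disjoint[OF H] H unfolding D_def by blast
  moreover have "D \<subseteq> ?V" using CH(2) HV unfolding D_def by blast
  ultimately have D: "minimal_vertex_cover G D"
    using C by (simp add: minimal_vertex_cover_iff_components)
  have finD: "finite D" using CH finite_connected_components by (auto simp: D_def)
  have "squarefree_exponent D + 0 \<in> cover_upset ?V G" unfolding cover_upset_def using D by (intro set_plus_intro) auto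
  moreover have "Poly_Mapping.lookup (squarefree_exponent D) t \<le> Poly_Mapping.lookup m t" for t
  proof (cases "t \<in> D")
    case True
    then obtain H where H: "H \<in> connected_components G" "t \<in> C H" by (auto simp: D_def)
    have "Poly_Mapping.lookup (restrict_exponent (verts H) m) t \<ge> 1"
      unfolding m[OF H(1)] using H CH by (simp add: lookup_add lookup_squarefree_exponent)
    then show ?thesis using True finD by (simp add: lookup_squarefree_exponent split: if_splits)
  qed (simp add: lookup_squarefree_exponent finD)
  ultimately show "m \<in> cover_upset ?V G"
    using upset_le[OF upset_cover_upset[OF finite_verts order_refl]] mV by simp
qed

theorem corollary5p4:
  fixes G :: "('v, 'e) pre_digraph"
    and S :: "('v, 'k::field) mpoly ring"
  assumes "graph G"
    and "S = poly_ring (verts G)"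
  shows
    "cover_ideal S G = (\<Otimes>\<^bsub>ideals_set S\<^esub>H \<in> connected_components G. cover_ideal S H) \<and>
     (\<forall>n\<ge>1. integral_closure S (ideal_pow S (cover_ideal S G) n) =
       (\<Otimes>\<^bsub>ideals_set S\<^esub>H \<in> connected_components G.
          integral_closure S (ideal_pow S (cover_ideal S H) n))) \<and>
     (normal_ideal S (cover_ideal S G) \<longleftrightarrow>
       (\<forall>H \<in> connected_components G. normal_ideal S (cover_ideal S H)))"
proof -
  interpret graph G by (rule assms(1))
  interpret R: cring S unfolding assms(2) by (rule cring_poly_ring)
  interpret M: comm_monoid "ideals_set S" by (rule R.ideals_set_is_comm_monoid)
  let ?I = "connected_components G" and ?U = "cover_upset (verts G) :: ('v, 'e) pre_digraph \<Rightarrow> _"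
  have HV: "verts H \<subseteq> verts G" if "H \<in> ?I" for H
    using component_subgraph[OF that] by auto
  note fin = finite_connected_components and dis = connected_components_disjoint
    and up = upset_cover_upset[OF finite_verts HV] and supp = restriction_closed_cover_upset[OF finite_verts HV]
  have ne: "?U H \<noteq> {}" if H: "H \<in> ?I" for H
  proof -
    interpret H: fin_digraph H using component_subgraph[OF H] by (rule fin_digraph_subgraph)
    obtain C where "minimal_vertex_cover H C" using H.ex_minimal_vertex_cover by blast
    then have "squarefree_exponent C + 0 \<in> ?U H" unfolding cover_upset_def by (intro set_plus_intro) auto
    then show ?thesis by blast
  qed
  have eqH: "cover_ideal S H = monomial_ideal (?U H)" if "H \<in> ?I" for H
    unfolding assms(2) by (rule cover_ideal_eq[OF finite_verts HV[OF that]])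
  have "cover_ideal S G = monomial_ideal (blockwise (verts G) ?I verts ?U)"
    unfolding assms(2) cover_ideal_eq[OF finite_verts order_refl] by (simp only: cover_upset_eq_blockwise)
  also have "\<dots> = (\<Otimes>\<^bsub>ideals_set S\<^esub>H\<in>?I. monomial_ideal (?U H))"
    unfolding assms(2) by (rule finprod_monomial_ideal[symmetric, OF fin dis up supp])
  finally have eqG: "cover_ideal S G = (\<Otimes>\<^bsub>ideals_set S\<^esub>H\<in>?I. monomial_ideal (?U H))" .
  have carrier: "ideal (monomial_ideal (?U H)) S" if "H \<in> ?I" for H
    unfolding assms(2) by (rule ideal_monomial_ideal[OF up[OF that]])
  have carrier_iff: "J \<in> carrier (ideals_set S) \<longleftrightarrow> ideal J S" for J
    by (simp add: ideals_set_def)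
  have a: "cover_ideal S G = (\<Otimes>\<^bsub>ideals_set S\<^esub>H\<in>?I. cover_ideal S H)"
    unfolding eqG by (intro M.finprod_cong') (simp_all add: eqH carrier_iff carrier)
  have b: "integral_closure S (ideal_pow S (cover_ideal S G) n) =
       (\<Otimes>\<^bsub>ideals_set S\<^esub>H\<in>?I. integral_closure S (ideal_pow S (cover_ideal S H) n))" for n
  proof -
    have G: "integral_closure S (ideal_pow S (cover_ideal S G) n)
      = (\<Otimes>\<^bsub>ideals_set S\<^esub>H\<in>?I. integral_closure S (ideal_pow S (monomial_ideal (?U H)) n))"
      unfolding eqG unfolding assms(2)
      by (rule integral_closure_pow_finprod[OF finite_verts fin dis up supp])
    have "ideal (integral_closure S (ideal_pow S (monomial_ideal (?U H)) n)) S" if "H \<in> ?I" for H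
      unfolding assms(2) ideal_pow_monomial_ideal integral_closure_monomial_ideal[OF finite_verts upset_upset_power[OF up[OF that]]]
      by (intro ideal_monomial_ideal upset_newton_closure upset_upset_power up that)
    then have "(\<Otimes>\<^bsub>ideals_set S\<^esub>H\<in>?I. integral_closure S (ideal_pow S (cover_ideal S H) n))
      = (\<Otimes>\<^bsub>ideals_set S\<^esub>H\<in>?I. integral_closure S (ideal_pow S (monomial_ideal (?U H)) n))"
      by (intro M.finprod_cong') (simp_all add: eqH carrier_iff)
    then show ?thesis unfolding G by simp
  qed
  have c: "normal_ideal S (cover_ideal S G) \<longleftrightarrow> (\<forall>H\<in>?I. normal_ideal S (cover_ideal S H))"
    unfolding eqG unfolding assms(2)
    using normal_finprod_iff[OF finite_verts fin dis up supp ne, where ?'k = 'k] eqH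
    by (simp add: assms(2))
  show ?thesis using a b c by blast
qed

end
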